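(* Assume $\mathfrak{c}=2^{\omega_1}$. Let $I=[-1,1]$, let $X=I^{\omega_1}$ with the lexicographic order, let $0\in X$ denote the constantly zero sequence, and let $$\mathbb{L}^{\omega_1}_{(X,0)}=\{x\in X^{\omega_1} : |\{\alpha<\omega_1 : x(\alpha)\ne 0\}|\le\omega\}$$ with the lexicographic order. Then $\mathbb{L}^{\omega_1}_{(X,0)}$ is a countably saturated linear order of cardinality $\mathfrak{c}$, of character $\omega_1$, and with $\operatorname{I-dim}\mathbb{L}^{\omega_1}_{(X,0)}=\omega_1^2$. In particular, $\mathbb{L}^{\omega_1}_{(X,0)}$ is not isomorphic to $$\mathbb{L}^{\omega_1}=\{x\in[-1,1]^{\omega_1} : |\{\alpha<\omega_1 : x(\alpha)\neq 0\}|\le\omega\}$$ with the lexicographic order.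
   Context: Work in ZFC. $\mathfrak{c}=2^{\aleph_0}$; in the hypothesis, $2^{\omega_1}$ is cardinal exponentiation. For a linear order $L$ and an ordinal $\alpha$, $L^\alpha$ is the set of functions $\alpha\to L$ ordered lexicographically. $K\hookrightarrow L$ means there is a (strictly) increasing function from $K$ to $L$. A linear order $L$ is countably saturated if for any countable linear orders $a,b$ and increasing functions $i:a\to b$, $f:a\to L$, there exists an increasing $\tilde f:b\to L$ with $\tilde f\circ i=f$. A linear order $L$ has character at most $\kappa$ if for each $l\in L$ there exist $A,B\subset L$ of cardinality at most $\kappa$ such that $A<B$ (every element of $A$ is less than every element of $B$) and $\{x\in L : A<\{x\}<B\}=\{l\}$; $L$ has character $\kappa$ if $\kappa$ is the least such cardinal. For a linear order $Y$, $\operatorname{I-dim}Y=\min\{\alpha\text{ an ordinal} : Y\hookrightarrow [-1,1]^\alpha\}$ (the same value is obtained with $\mathbb{R}$, $[0,1]$ or $2^\omega$ in place of $[-1,1]$). $\omega_1^2$ is the ordinal product $\omega_1\cdot\omega_1$. *)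

theory Defs
  imports Complex_Main "HOL-Library.FuncSet" "HOL-Library.Countable_Set"
begin

text \<open>
  A linear order is a reflexive relation \<open>L\<close> with \<^term>\<open>Linear_order L\<close>; its underlying set is
  \<^term>\<open>Field L\<close>. Ordinals are well-orders up to \<open>=o\<close>, cardinals are well-orders satisfying
  \<^const>\<open>card_order_on\<close>.
\<close>

unbundle cardinal_syntax

abbreviation strictly_below :: "'a rel \<Rightarrow> 'a \<Rightarrow> 'a \<Rightarrow> bool" where
  "strictly_below L x y \<equiv> (x, y) \<in> L \<and> x \<noteq> y"

definition increasing :: "'a rel \<Rightarrow> 'b rel \<Rightarrow> ('a \<Rightarrow> 'b) \<Rightarrow> bool" where
  "increasing K L f \<longleftrightarrow>
     f \<in> Field K \<rightarrow> Field L \<and>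
     (\<forall>x y. strictly_below K x y \<longrightarrow> strictly_below L (f x) (f y))"

definition embeds :: "'a rel \<Rightarrow> 'b rel \<Rightarrow> bool" where
  "embeds K L \<longleftrightarrow> (\<exists>f. increasing K L f)"

text \<open>\<open>lex_pow L \<alpha>\<close> is the lexicographic power \<open>L\<^sup>\<alpha>\<close>; functions are taken extensional on
  \<^term>\<open>Field \<alpha>\<close>, so that each function on the ordinal is represented exactly once.\<close>

definition lex_pow :: "'a rel \<Rightarrow> 'i rel \<Rightarrow> ('i \<Rightarrow> 'a) rel" where
  "lex_pow L \<alpha> = {(x, y).
     x \<in> Field \<alpha> \<rightarrow>\<^sub>E Field L \<and> y \<in> Field \<alpha> \<rightarrow>\<^sub>E Field L \<and>
     (x = y \<or> (\<exists>i\<in>Field \<alpha>. (\<forall>j\<in>underS \<alpha> i. x j = y j) \<and> strictly_below L (x i) (y i)))}"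

definition lex_pow_countable_support :: "'a rel \<Rightarrow> 'a \<Rightarrow> 'i rel \<Rightarrow> ('i \<Rightarrow> 'a) rel" where
  "lex_pow_countable_support L z \<alpha> =
     Restr (lex_pow L \<alpha>) {x. countable {i \<in> Field \<alpha>. x i \<noteq> z}}"

text \<open>Every countable linear order is isomorphic to one whose underlying set consists of natural
  numbers, so it suffices to quantify over relations on \<^typ>\<open>nat\<close>; see
  \<open>countably_saturatedD\<close> below for arbitrary types.\<close>

definition countably_saturated :: "'a rel \<Rightarrow> bool" where
  "countably_saturated L \<longleftrightarrow>
     (\<forall>(a :: nat rel) (b :: nat rel) i f.
        Linear_order a \<and> Linear_order b \<and> increasing a b i \<and> increasing a L f \<longrightarrow>
        (\<exists>f'. increasing b L f' \<and> (\<forall>x\<in>Field a. f' (i x) = f x)))"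

definition character_at_most :: "'a rel \<Rightarrow> 'k rel \<Rightarrow> bool" where
  "character_at_most L \<kappa> \<longleftrightarrow>
     (\<forall>l\<in>Field L. \<exists>A B. A \<subseteq> Field L \<and> B \<subseteq> Field L \<and> |A| \<le>o \<kappa> \<and> |B| \<le>o \<kappa> \<and>
        (\<forall>a\<in>A. \<forall>b\<in>B. strictly_below L a b) \<and>
        {x \<in> Field L. (\<forall>a\<in>A. strictly_below L a x) \<and> (\<forall>b\<in>B. strictly_below L x b)} = {l})"

text \<open>In the next two definitions minimality refers to cardinals and ordinals on the same type.
  This loses nothing, as all smaller ones are represented by initial segments of the given one; see
  \<open>has_character_least\<close> and \<open>is_I_dim_least\<close> below.\<close>

definition has_character :: "'a rel \<Rightarrow> 'k rel \<Rightarrow> bool" where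
  "has_character L \<kappa> \<longleftrightarrow>
     Card_order \<kappa> \<and> character_at_most L \<kappa> \<and>
     (\<forall>\<mu> :: 'k rel. Card_order \<mu> \<and> character_at_most L \<mu> \<longrightarrow> \<kappa> \<le>o \<mu>)"

definition I_order :: "real rel" where
  "I_order = {(x, y). x \<in> {-1..1} \<and> y \<in> {-1..1} \<and> x \<le> y}"

definition is_I_dim :: "'a rel \<Rightarrow> 'i rel \<Rightarrow> bool" where
  "is_I_dim Y \<alpha> \<longleftrightarrow>
     Well_order \<alpha> \<and> embeds Y (lex_pow I_order \<alpha>) \<and>
     (\<forall>\<beta> :: 'i rel. Well_order \<beta> \<and> embeds Y (lex_pow I_order \<beta>) \<longrightarrow> \<alpha> \<le>o \<beta>)"

text \<open>Ordinal product: \<open>\<beta>\<close> many copies of \<open>\<alpha>\<close>, the second coordinate being the most significant.\<close>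

definition ord_prod :: "'i rel \<Rightarrow> 'j rel \<Rightarrow> ('i \<times> 'j) rel" where
  "ord_prod \<alpha> \<beta> = {((x, y), (x', y')).
     x \<in> Field \<alpha> \<and> x' \<in> Field \<alpha> \<and> y \<in> Field \<beta> \<and> y' \<in> Field \<beta> \<and>
     (strictly_below \<beta> y y' \<or> y = y' \<and> (x, x') \<in> \<alpha>)}"

definition continuum :: "(nat \<Rightarrow> bool) rel" where
  "continuum = ctwo ^c natLeq"

definition omega1 :: "nat set rel" where
  "omega1 = cardSuc natLeq"

definition X_order :: "(nat set \<Rightarrow> real) rel" where
  "X_order = lex_pow I_order omega1"

definition X_zero :: "nat set \<Rightarrow> real" where
  "X_zero = (\<lambda>\<alpha>\<in>Field omega1. 0)"

definition L_X :: "(nat set \<Rightarrow> nat set \<Rightarrow> real) rel" where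
  "L_X = lex_pow_countable_support X_order X_zero omega1"

definition L_I :: "(nat set \<Rightarrow> real) rel" where
  "L_I = lex_pow_countable_support I_order 0 omega1"


lemma Field_lex_pow: "Field (lex_pow L \<alpha>) = Field \<alpha> \<rightarrow>\<^sub>E Field L"
proof
  show "Field (lex_pow L \<alpha>) \<subseteq> Field \<alpha> \<rightarrow>\<^sub>E Field L"
  proof
    fix x assume "x \<in> Field (lex_pow L \<alpha>)"
    then obtain y where "(x, y) \<in> lex_pow L \<alpha> \<or> (y, x) \<in> lex_pow L \<alpha>"
      unfolding Field_def by blast
    then show "x \<in> Field \<alpha> \<rightarrow>\<^sub>E Field L" unfolding lex_pow_def by blast
  qed
  show "Field \<alpha> \<rightarrow>\<^sub>E Field L \<subseteq> Field (lex_pow L \<alpha>)"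
  proof
    fix x assume "x \<in> Field \<alpha> \<rightarrow>\<^sub>E Field L"
    then have "(x, x) \<in> lex_pow L \<alpha>" unfolding lex_pow_def by blast
    then show "x \<in> Field (lex_pow L \<alpha>)" by (rule FieldI1)
  qed
qed

lemma increasing_comp: "increasing K L f \<Longrightarrow> increasing L M g \<Longrightarrow> increasing K M (g \<circ> f)"
  unfolding increasing_def by (auto simp: Pi_iff)

lemma smaller_on_same_type:
  fixes \<alpha> :: "'i rel" and \<beta> :: "'j rel"
  assumes "Well_order \<alpha>" "Well_order \<beta>" "\<not> \<alpha> \<le>o \<beta>"
  obtains \<gamma> :: "'i rel" where "\<gamma> =o \<beta>" "\<gamma> <o \<alpha>"
proof -
  have "\<beta> <o \<alpha>" using assms not_ordLeq_iff_ordLess by blast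
  then obtain a where "a \<in> Field \<alpha>" "\<beta> =o Restr \<alpha> (underS \<alpha> a)"
    using assms ordLess_iff_ordIso_Restr by blast
  then show thesis
    using that \<open>\<beta> <o \<alpha>\<close> ordIso_symmetric ordIso_ordLess_trans by blast
qed

lemma has_character_least:
  fixes \<kappa> :: "'k rel" and \<mu> :: "'m rel"
  assumes "has_character L \<kappa>" "Card_order \<mu>" "character_at_most L \<mu>"
  shows "\<kappa> \<le>o \<mu>"
proof (rule ccontr)
  assume not: "\<not> \<kappa> \<le>o \<mu>"
  have "Well_order \<kappa>" "Well_order \<mu>"
    using assms by (auto simp: has_character_def card_order_on_def)
  with not obtain \<gamma> :: "'k rel" where \<gamma>: "\<gamma> =o \<mu>" "\<gamma> <o \<kappa>"
    by (metis smaller_on_same_type)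
  have "Card_order \<gamma>" using \<gamma>(1) assms(2) Card_order_ordIso by blast
  moreover have "character_at_most L \<gamma>"
  proof -
    have "|A| \<le>o \<mu> \<longleftrightarrow> |A| \<le>o \<gamma>" for A :: "'a set"
      using ordLeq_ordIso_trans[OF _ \<gamma>(1)] ordLeq_ordIso_trans[OF _ ordIso_symmetric[OF \<gamma>(1)]]
      by metis
    then show ?thesis using assms(3) unfolding character_at_most_def by simp
  qed
  ultimately have "\<kappa> \<le>o \<gamma>" using assms(1) unfolding has_character_def by blast
  then show False using \<gamma>(2) not_ordLess_ordLeq by blast
qed

lemma embeds_lex_pow_ordIso:
  fixes L :: "'a rel"
  assumes "embeds Y (lex_pow L \<beta>)" "\<gamma> =o \<beta>"
  shows "embeds Y (lex_pow L \<gamma>)"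
proof -
  obtain h where h: "iso \<gamma> \<beta> h" using assms(2) unfolding ordIso_def by auto
  then have bij: "bij_betw h (Field \<gamma>) (Field \<beta>)" and em: "embed \<gamma> \<beta> h"
    by (auto simp: iso_def)
  have wo: "Well_order \<gamma>" "Well_order \<beta>" using assms(2) unfolding ordIso_def by auto
  define g where "g = (\<lambda>(x :: _ \<Rightarrow> 'a). \<lambda>j\<in>Field \<gamma>. x (h j))"
  have "increasing (lex_pow L \<beta>) (lex_pow L \<gamma>) g"
    unfolding increasing_def
  proof (intro conjI allI impI)
    show g: "g \<in> Field (lex_pow L \<beta>) \<rightarrow> Field (lex_pow L \<gamma>)"
      using bij unfolding Field_lex_pow g_def bij_betw_def by (fastforce dest: PiE_mem)
    fix x y assume xy: "strictly_below (lex_pow L \<beta>) x y"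
    then obtain i where i: "i \<in> Field \<beta>" "\<forall>j\<in>underS \<beta> i. x j = y j"
      "(x i, y i) \<in> L" "x i \<noteq> y i"
      and F: "x \<in> Field \<beta> \<rightarrow>\<^sub>E Field L" "y \<in> Field \<beta> \<rightarrow>\<^sub>E Field L"
      unfolding lex_pow_def by auto
    obtain k where k: "k \<in> Field \<gamma>" "h k = i" using bij i(1) unfolding bij_betw_def by (metis imageE)
    have "bij_betw h (underS \<gamma> k) (underS \<beta> i)"
      using embed_underS[OF wo(1) em k(1)] k(2) by simp
    then have eq: "\<forall>j\<in>underS \<gamma> k. g x j = g y j"
      using i(2) by (auto simp: bij_betw_def g_def)
    have "strictly_below L (g x k) (g y k)" using k i by (simp add: g_def)
    moreover have "g x \<in> Field \<gamma> \<rightarrow>\<^sub>E Field L" "g y \<in> Field \<gamma> \<rightarrow>\<^sub>E Field L"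
      using g F unfolding Field_lex_pow by auto
    ultimately show "(g x, g y) \<in> lex_pow L \<gamma>" "g x \<noteq> g y"
      using eq k(1) unfolding lex_pow_def by auto
  qed
  moreover obtain f where "increasing Y (lex_pow L \<beta>) f"
    using assms(1) unfolding embeds_def by blast
  ultimately show ?thesis unfolding embeds_def by (intro exI) (rule increasing_comp)
qed

lemma is_I_dim_least:
  fixes \<alpha> :: "'i rel" and \<beta> :: "'j rel"
  assumes "is_I_dim Y \<alpha>" "Well_order \<beta>" "embeds Y (lex_pow I_order \<beta>)"
  shows "\<alpha> \<le>o \<beta>"
proof (rule ccontr)
  assume "\<not> \<alpha> \<le>o \<beta>"
  then obtain \<gamma> :: "'i rel" where \<gamma>: "\<gamma> =o \<beta>" "\<gamma> <o \<alpha>"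
    using assms smaller_on_same_type unfolding is_I_dim_def by metis
  then have "Well_order \<gamma>" unfolding ordIso_def by auto
  then have "\<alpha> \<le>o \<gamma>"
    using assms(1) embeds_lex_pow_ordIso[OF assms(3) \<gamma>(1)] unfolding is_I_dim_def by blast
  then show False using \<gamma>(2) not_ordLess_ordLeq by blast
qed

lemma countable_copy_on_nat:
  fixes a :: "'a rel"
  assumes "Linear_order a" "countable (Field a)"
  defines "e \<equiv> to_nat_on (Field a)" and "d \<equiv> from_nat_into (Field a)"
  obtains a' where "Linear_order a'" "increasing a a' e" "increasing a' a d"
    "\<And>x. x \<in> Field a \<Longrightarrow> d (e x) = x" "Field a' = e ` Field a"
proof -
  define a' where "a' = {(e x, e y) |x y. (x, y) \<in> a}"
  have de: "d (e x) = x" if "x \<in> Field a" for x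
    using that assms(2) unfolding d_def e_def by simp
  have F: "Field a' = e ` Field a" unfolding a'_def Field_def by force
  have mem: "(e x, e y) \<in> a' \<longleftrightarrow> (x, y) \<in> a" if "x \<in> Field a" "y \<in> Field a" for x y
    using that de unfolding a'_def by (auto, metis FieldI1 FieldI2)
  have lin: "refl_on (Field a) a" "trans a" "antisym a" "total_on (Field a) a"
    using assms(1) by (auto simp: order_on_defs)
  have sub: "p \<in> a' \<Longrightarrow> \<exists>x y. x \<in> Field a \<and> y \<in> Field a \<and> p = (e x, e y)" for p
    unfolding a'_def by (auto intro: FieldI1 FieldI2)
  have ref: "refl_on (Field a') a'"
    using lin(1) unfolding F refl_on_def by (auto simp: mem)
  have tr: "trans a'"
  proof (rule transI)
    fix u v w assume "(u, v) \<in> a'" "(v, w) \<in> a'"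
    with sub obtain x y y' z where
      "x \<in> Field a" "y \<in> Field a" "y' \<in> Field a" "z \<in> Field a"
      "u = e x" "v = e y" "v = e y'" "w = e z" by (metis Pair_inject)
    moreover from this have "y = y'" using de by metis
    ultimately show "(u, w) \<in> a'"
      using \<open>(u, v) \<in> a'\<close> \<open>(v, w) \<in> a'\<close> mem lin(2) by (metis transD)
  qed
  have an: "antisym a'"
  proof (rule antisymI)
    fix u v assume uv: "(u, v) \<in> a'" "(v, u) \<in> a'"
    with sub obtain x y where "x \<in> Field a" "y \<in> Field a" "u = e x" "v = e y"
      by (metis Pair_inject)
    then show "u = v" using uv mem lin(3) by (metis antisymD)
  qed
  have tot: "total_on (Field a') a'"
    using lin(4) unfolding F total_on_def by (auto simp: mem)
  have "Linear_order a'"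
    using ref tr an tot by (auto simp: order_on_defs intro: FieldI1 FieldI2)
  moreover have "increasing a a' e"
    unfolding increasing_def F using mem de by (auto intro: FieldI1 FieldI2) (metis FieldI1 FieldI2)
  moreover have "increasing a' a d"
    unfolding increasing_def F
  proof (intro conjI allI impI)
    show "d \<in> e ` Field a \<rightarrow> Field a" by (auto simp: de)
    fix u v assume uv: "strictly_below a' u v"
    with sub obtain x y where "x \<in> Field a" "y \<in> Field a" "u = e x" "v = e y"
      by (metis Pair_inject)
    then show "(d u, d v) \<in> a" "d u \<noteq> d v" using uv mem de by auto
  qed
  ultimately show thesis using de F by (rule that)
qed

lemma countably_saturatedD:
  fixes a :: "'b rel" and b :: "'c rel"
  assumes L: "countably_saturated L"
    and a: "Linear_order a" "countable (Field a)" and b: "Linear_order b" "countable (Field b)"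
    and i: "increasing a b i" and f: "increasing a L f"
  shows "\<exists>f'. increasing b L f' \<and> (\<forall>x\<in>Field a. f' (i x) = f x)"
proof -
  obtain a' :: "nat rel" and ea da where a': "Linear_order a'" "increasing a a' ea"
    "increasing a' a da" "\<And>x. x \<in> Field a \<Longrightarrow> da (ea x) = x" "Field a' = ea ` Field a"
    by (rule countable_copy_on_nat[OF a]) (rule that)
  obtain b' :: "nat rel" and eb where b': "Linear_order b'" "increasing b b' eb"
    by (rule countable_copy_on_nat[OF b]) (rule that)
  have "increasing a' b' (eb \<circ> (i \<circ> da))"
    by (intro increasing_comp[OF increasing_comp]) (fact a'(3) i b'(2))+
  moreover have "increasing a' L (f \<circ> da)" by (rule increasing_comp) (fact a'(3) f)+
  ultimately have "\<exists>g. increasing b' L g \<and> (\<forall>x\<in>Field a'. g ((eb \<circ> (i \<circ> da)) x) = (f \<circ> da) x)"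
    using L a'(1) b'(1) unfolding countably_saturated_def by metis
  then obtain g where g: "increasing b' L g" "\<And>x. x \<in> Field a' \<Longrightarrow> g (eb (i (da x))) = f (da x)"
    by auto
  have "increasing b L (g \<circ> eb)" by (rule increasing_comp) (fact b'(2) g(1))+
  moreover have "(g \<circ> eb) (i x) = f x" if "x \<in> Field a" for x
    using g(2)[of "ea x"] a'(4)[OF that] a'(5) that by simp
  ultimately show ?thesis by (intro exI[of _ "g \<circ> eb"]) simp
qed

end

theory Submission
  imports Defs "HOL-Library.Countable_Set_Type"
    "HOL-Analysis.Abstract_Topology_2"
begin

text \<open>
  Countable saturation: between countable sets \<open>A < B\<close> one either modifies \<open>max A\<close> or \<open>min B\<close> at a
  coordinate beyond all supports or, if neither exists, takes the least upper bound of \<open>A\<close> in the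
  complete order \<open>X\<^sup>\<delta>\<close> for some countable \<open>\<delta>\<close> bounding the supports. Saturation also excludes a
  countable character. The assumption on the continuum enters only through
  \<open>(\<cc>\<^bsup>\<omega>\<^sub>1\<^esup>)\<^bsup>\<omega>\<^sub>1\<^esup> = 2\<^bsup>\<omega>\<^sub>1\<^esup> = \<cc>\<close>.

  Dimension: flattening embeds the order into \<open>I\<^bsup>\<omega>\<^sub>1\<cdot>\<omega>\<^sub>1\<^esup>\<close>. Given an increasing map into \<open>I\<^sup>\<beta>\<close>, where
  \<open>\<beta>\<close> is a proper initial segment of \<open>\<omega>\<^sub>1\<cdot>\<omega>\<^sub>1\<close>, one chooses a sequence \<open>s\<close> of length \<open>\<beta>\<close> such that the
  map is constant on the cone of all points extending \<open>s\<close>. Only countably many blocks meet \<open>\<beta>\<close>, so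
  this cone contains two points of countable support: contradiction.
\<close>

section \<open>Lexicographic powers\<close>

lemma strictly_below_Field:
  "strictly_below L x y \<Longrightarrow> x \<in> Field L \<and> y \<in> Field L"
  by (auto simp: Field_def)

lemma strictly_below_le_trans:
  assumes "Linear_order L" "strictly_below L x y" "(y, z) \<in> L"
  shows "strictly_below L x z"
proof -
  have "trans L" "antisym L" using assms(1) by (auto simp: order_on_defs)
  then show ?thesis using assms(2,3) by (blast dest: transD antisymD)
qed

lemma le_strictly_below_trans:
  assumes "Linear_order L" "(x, y) \<in> L" "strictly_below L y z"
  shows "strictly_below L x z"
proof -
  have "trans L" "antisym L" using assms(1) by (auto simp: order_on_defs)
  then show ?thesis using assms(2,3) by (blast dest: transD antisymD)
qed

lemma strictly_below_trans:
  "Linear_order L \<Longrightarrow> strictly_below L x y \<Longrightarrow> strictly_below L y z \<Longrightarrow> strictly_below L x z"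
  using strictly_below_le_trans[of L x y z] by blast

lemma strictly_below_not_le:
  assumes "Linear_order L" "strictly_below L x y"
  shows "(y, x) \<notin> L"
proof -
  have "antisym L" using assms(1) by (auto simp: order_on_defs)
  then show ?thesis using assms(2) by (blast dest: antisymD)
qed

lemma Linear_order_refl: "Linear_order L \<Longrightarrow> x \<in> Field L \<Longrightarrow> (x, x) \<in> L"
  by (auto simp: order_on_defs dest: refl_onD)

lemma Linear_order_cases:
  assumes "Linear_order L" "x \<in> Field L" "y \<in> Field L"
  obtains "strictly_below L x y" | "x = y" | "strictly_below L y x"
proof -
  have "total_on (Field L) L" using assms(1) by (auto simp: order_on_defs)
  then show thesis using assms(2,3) that unfolding total_on_def by blast
qed

lemma Linear_order_not_le:
  assumes "Linear_order L" "x \<in> Field L" "y \<in> Field L" "(x, y) \<notin> L"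
  shows "strictly_below L y x"
  using Linear_order_cases[OF assms(1-3)] Linear_order_refl[OF assms(1,2)] assms(4) by blast

section \<open>Well-orders and their initial segments\<close>

lemma Well_order_induct [consumes 1, case_names less]:
  assumes "Well_order \<alpha>" "\<And>i. (\<And>j. j \<in> underS \<alpha> i \<Longrightarrow> P j) \<Longrightarrow> P i"
  shows "P i"
proof -
  have "wf (\<alpha> - Id)" using assms(1) by (simp add: well_order_on_def)
  then show ?thesis
    by (induction i rule: wf_induct_rule) (rule assms(2), auto simp: underS_def)
qed

lemma Well_order_first:
  assumes "Well_order \<alpha>" "P i"
  obtains k where "P k" "\<And>j. j \<in> underS \<alpha> k \<Longrightarrow> \<not> P j"
  using Well_order_induct[OF assms(1), of "\<lambda>i. \<not> P i" i] assms(2) by blast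

lemma Well_order_Linear: "Well_order \<alpha> \<Longrightarrow> Linear_order \<alpha>"
  by (simp add: well_order_on_def)

lemma underS_trans:
  "Linear_order \<alpha> \<Longrightarrow> i \<in> underS \<alpha> j \<Longrightarrow> j \<in> underS \<alpha> k \<Longrightarrow> i \<in> underS \<alpha> k"
  using strictly_below_trans[of \<alpha> i j k] by (auto simp: underS_def)

lemma underS_cases:
  assumes "Linear_order \<alpha>" "i \<in> Field \<alpha>" "j \<in> Field \<alpha>"
  obtains "i \<in> underS \<alpha> j" | "i = j" | "j \<in> underS \<alpha> i"
  using Linear_order_cases[OF assms] by (auto simp: underS_def)

section \<open>Comparison at the first difference\<close>

lemma lex_powI:
  assumes "x \<in> Field (lex_pow L \<alpha>)" "y \<in> Field (lex_pow L \<alpha>)" "i \<in> Field \<alpha>"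
    "\<And>j. j \<in> underS \<alpha> i \<Longrightarrow> x j = y j" "strictly_below L (x i) (y i)"
  shows "strictly_below (lex_pow L \<alpha>) x y"
  using assms unfolding Field_lex_pow unfolding lex_pow_def by blast

lemma lex_powE:
  assumes "strictly_below (lex_pow L \<alpha>) x y"
  obtains i where "x \<in> Field (lex_pow L \<alpha>)" "y \<in> Field (lex_pow L \<alpha>)" "i \<in> Field \<alpha>"
    "\<And>j. j \<in> underS \<alpha> i \<Longrightarrow> x j = y j" "strictly_below L (x i) (y i)"
  using assms unfolding Field_lex_pow unfolding lex_pow_def by auto

text \<open>Members are extensional, so distinct ones differ at some index in the field of
  \<open>\<alpha>\<close>, and there is a least such index.\<close>

lemma lex_pow_first_difference:
  assumes "Well_order \<alpha>" "x \<in> Field (lex_pow L \<alpha>)" "y \<in> Field (lex_pow L \<alpha>)" "x \<noteq> y"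
  obtains i where "i \<in> Field \<alpha>" "x i \<noteq> y i" "\<And>j. j \<in> underS \<alpha> i \<Longrightarrow> x j = y j"
proof -
  have "\<exists>i. i \<in> Field \<alpha> \<and> x i \<noteq> y i"
    using assms(2-4) unfolding Field_lex_pow by (metis PiE_ext)
  then obtain k where k: "k \<in> Field \<alpha> \<and> x k \<noteq> y k"
    "\<And>j. j \<in> underS \<alpha> k \<Longrightarrow> \<not> (j \<in> Field \<alpha> \<and> x j \<noteq> y j)"
    using Well_order_first[OF assms(1), of "\<lambda>i. i \<in> Field \<alpha> \<and> x i \<noteq> y i"] by metis
  then show thesis using that[of k] by (auto simp: underS_def Field_def)
qed

lemma lex_pow_cases:
  assumes "Linear_order L" "Well_order \<alpha>"
    and x: "x \<in> Field (lex_pow L \<alpha>)" and y: "y \<in> Field (lex_pow L \<alpha>)"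
  obtains "strictly_below (lex_pow L \<alpha>) x y" | "x = y" | "strictly_below (lex_pow L \<alpha>) y x"
proof (cases "x = y")
  case False
  then obtain i where i: "i \<in> Field \<alpha>" "x i \<noteq> y i" "\<And>j. j \<in> underS \<alpha> i \<Longrightarrow> x j = y j"
    using lex_pow_first_difference[OF assms(2) x y] by blast
  then have "x i \<in> Field L" "y i \<in> Field L"
    using x y unfolding Field_lex_pow by auto
  then show thesis
    by (rule Linear_order_cases[OF assms(1)])
      (use that lex_powI[OF x y i(1)] lex_powI[OF y x i(1)] i in auto)
qed (use that in blast)

text \<open>The earlier of the two positions of difference is where \<open>x\<close> and
  \<open>z\<close> first differ: before it all three sequences agree.\<close>

lemma lex_pow_trans:
  assumes "Linear_order L" "Well_order \<alpha>"
    and "strictly_below (lex_pow L \<alpha>) x y" "strictly_below (lex_pow L \<alpha>) y z"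
  shows "strictly_below (lex_pow L \<alpha>) x z"
proof -
  note lin = Well_order_Linear[OF assms(2)]
  obtain i where x: "x \<in> Field (lex_pow L \<alpha>)" and i: "i \<in> Field \<alpha>"
    "\<And>j. j \<in> underS \<alpha> i \<Longrightarrow> x j = y j" "strictly_below L (x i) (y i)"
    using lex_powE[OF assms(3)] by metis
  obtain k where z: "z \<in> Field (lex_pow L \<alpha>)" and k: "k \<in> Field \<alpha>"
    "\<And>j. j \<in> underS \<alpha> k \<Longrightarrow> y j = z j" "strictly_below L (y k) (z k)"
    using lex_powE[OF assms(4)] by metis
  show ?thesis
  proof (rule underS_cases[OF lin i(1) k(1)])
    assume "i \<in> underS \<alpha> k"
    then show ?thesis
      using i(2) k(2) underS_trans[OF lin _ \<open>i \<in> underS \<alpha> k\<close>] i(3)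
      by (intro lex_powI[OF x z i(1)]) (simp_all add: \<open>i \<in> underS \<alpha> k\<close>)
  next
    assume "i = k"
    then show ?thesis
      using i(2) k(2) strictly_below_trans[OF assms(1) i(3)] k(3)
      by (intro lex_powI[OF x z i(1)]) auto
  next
    assume "k \<in> underS \<alpha> i"
    then show ?thesis
      using i(2) k(2) underS_trans[OF lin _ \<open>k \<in> underS \<alpha> i\<close>] k(3)
      by (intro lex_powI[OF x z k(1)]) (simp_all add: \<open>k \<in> underS \<alpha> i\<close>)
  qed
qed

lemma lex_pow_irrefl:
  assumes "Linear_order L" "Well_order \<alpha>" "strictly_below (lex_pow L \<alpha>) x y"
  shows "(y, x) \<notin> lex_pow L \<alpha>"
proof
  assume "(y, x) \<in> lex_pow L \<alpha>"
  then have yx: "strictly_below (lex_pow L \<alpha>) y x" using assms(3) by auto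
  from lex_pow_trans[OF assms this] show False by simp
qed

lemma Linear_order_lex_pow:
  assumes "Linear_order L" "Well_order \<alpha>"
  shows "Linear_order (lex_pow L \<alpha>)"
proof -
  let ?M = "lex_pow L \<alpha>"
  have "refl_on (Field ?M) ?M"
    unfolding Field_lex_pow by (auto simp: refl_on_def lex_pow_def)
  moreover have "trans ?M"
    using lex_pow_trans[OF assms] by (intro transI) blast
  moreover have "antisym ?M"
    using lex_pow_irrefl[OF assms] by (intro antisymI) blast
  moreover have "total_on (Field ?M) ?M"
    unfolding total_on_def by (blast intro: lex_pow_cases[OF assms])
  ultimately show ?thesis
    by (auto simp: order_on_defs intro: FieldI1 FieldI2)
qed

section \<open>Changing a single coordinate\<close>

lemma Field_fun_upd:
  assumes "x \<in> Field (lex_pow L \<alpha>)" "i \<in> Field \<alpha>" "c \<in> Field L"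
  shows "x(i := c) \<in> Field (lex_pow L \<alpha>)"
  using assms unfolding Field_lex_pow by (auto simp: PiE_iff extensional_def)

lemma strictly_below_fun_upd:
  assumes "x \<in> Field (lex_pow L \<alpha>)" "i \<in> Field \<alpha>" "strictly_below L (x i) c"
  shows "strictly_below (lex_pow L \<alpha>) x (x(i := c))"
  using assms strictly_below_Field[OF assms(3)]
  by (intro lex_powI[where i = i]) (auto intro: Field_fun_upd simp: underS_def)

lemma fun_upd_strictly_below:
  assumes "x \<in> Field (lex_pow L \<alpha>)" "i \<in> Field \<alpha>" "strictly_below L c (x i)"
  shows "strictly_below (lex_pow L \<alpha>) (x(i := c)) x"
  using assms strictly_below_Field[OF assms(3)]
  by (intro lex_powI[where i = i]) (auto intro: Field_fun_upd simp: underS_def)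

lemma lex_pow_const:
  "c \<in> Field L \<Longrightarrow> (\<lambda>i\<in>Field \<alpha>. c) \<in> Field (lex_pow L \<alpha>)"
  unfolding Field_lex_pow by auto

section \<open>Sequences of countable support\<close>

lemma Field_lex_pow_countable_support:
  "Field (lex_pow_countable_support L z \<alpha>) =
     {x \<in> Field (lex_pow L \<alpha>). countable {i \<in> Field \<alpha>. x i \<noteq> z}}"
proof -
  have "refl_on (Field (lex_pow L \<alpha>)) (lex_pow L \<alpha>)"
    unfolding Field_lex_pow by (auto simp: refl_on_def lex_pow_def)
  from Refl_Field_Restr[OF this] show ?thesis
    unfolding lex_pow_countable_support_def by auto
qed

lemma strictly_below_countable_support:
  assumes "x \<in> Field (lex_pow_countable_support L z \<alpha>)"
    "y \<in> Field (lex_pow_countable_support L z \<alpha>)"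
  shows "strictly_below (lex_pow_countable_support L z \<alpha>) x y \<longleftrightarrow> strictly_below (lex_pow L \<alpha>) x y"
  using assms unfolding Field_lex_pow_countable_support
  by (auto simp: lex_pow_countable_support_def)

lemma strictly_below_lex_pow:
  "strictly_below (lex_pow_countable_support L z \<alpha>) x y \<Longrightarrow> strictly_below (lex_pow L \<alpha>) x y"
  by (auto simp: lex_pow_countable_support_def)

lemma Linear_order_countable_support:
  "Linear_order L \<Longrightarrow> Well_order \<alpha> \<Longrightarrow> Linear_order (lex_pow_countable_support L z \<alpha>)"
  unfolding lex_pow_countable_support_def
  by (intro Linear_order_Restr Linear_order_lex_pow)

lemma fun_upd_countable_support:
  assumes "x \<in> Field (lex_pow_countable_support L z \<alpha>)" "i \<in> Field \<alpha>" "c \<in> Field L"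
  shows "x(i := c) \<in> Field (lex_pow_countable_support L z \<alpha>)"
proof -
  have "{j \<in> Field \<alpha>. (x(i := c)) j \<noteq> z} \<subseteq> insert i {j \<in> Field \<alpha>. x j \<noteq> z}" by auto
  moreover have "countable (insert i {j \<in> Field \<alpha>. x j \<noteq> z})"
    using assms(1) unfolding Field_lex_pow_countable_support by simp
  ultimately have "countable {j \<in> Field \<alpha>. (x(i := c)) j \<noteq> z}" by (rule countable_subset)
  then show ?thesis
    using assms Field_fun_upd[of x L \<alpha> i c] unfolding Field_lex_pow_countable_support by blast
qed

section \<open>Completeness\<close>

definition is_lub :: "'a rel \<Rightarrow> 'a set \<Rightarrow> 'a \<Rightarrow> bool" where
  "is_lub L S r \<longleftrightarrow> r \<in> Field L \<and> (\<forall>s\<in>S. (s, r) \<in> L) \<and>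
     (\<forall>t\<in>Field L. (\<forall>s\<in>S. (s, t) \<in> L) \<longrightarrow> (r, t) \<in> L)"

text \<open>The empty set is included, so a least element exists. In \<open>lex_pow_lub\<close> this
  supplies the next coordinate once no element of \<open>A\<close> agrees with the sequence built so
  far.\<close>

definition complete_order :: "'a rel \<Rightarrow> bool" where
  "complete_order L \<longleftrightarrow> (\<forall>S\<subseteq>Field L. \<exists>r. is_lub L S r)"

text \<open>The coordinates of the least upper bound are found one after the other: the \<open>i\<close>-th one is the
  least upper bound of the \<open>i\<close>-th coordinates of those elements that agree with it so far.
  The set \<open>D\<close> confines this to sequences that are \<open>z\<close> outside of an initial segment.\<close>

lemma lex_pow_lub:
  assumes L: "Linear_order L" "complete_order L" and \<alpha>: "Well_order \<alpha>"
    and z: "z \<in> Field L"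
    and A: "A \<subseteq> Field (lex_pow L \<alpha>)" "\<And>a i. a \<in> A \<Longrightarrow> i \<in> Field \<alpha> - D \<Longrightarrow> a i = z"
  obtains s where "s \<in> Field (lex_pow L \<alpha>)" "\<And>i. i \<in> Field \<alpha> - D \<Longrightarrow> s i = z"
    "\<And>a. a \<in> A \<Longrightarrow> (a, s) \<in> lex_pow L \<alpha>"
    "\<And>t. t \<in> Field (lex_pow L \<alpha>) \<Longrightarrow> (\<And>i. i \<in> Field \<alpha> - D \<Longrightarrow> t i = z) \<Longrightarrow>
       (\<And>a. a \<in> A \<Longrightarrow> (a, t) \<in> lex_pow L \<alpha>) \<Longrightarrow> (s, t) \<in> lex_pow L \<alpha>"
proof -
  let ?M = "lex_pow L \<alpha>"
  define S where "S s i = {a i |a. a \<in> A \<and> (\<forall>j\<in>underS \<alpha> i. a j = s j)}" for s i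
  \<comment> \<open>\<open>P s i\<close> looks at \<open>s\<close> only below \<open>i\<close>,
    which permits a choice along the well-order. The value \<open>undefined\<close> off the field
    makes the chosen function extensional.\<close>
  define P where "P s i r \<longleftrightarrow> (if i \<in> Field \<alpha> \<inter> D then is_lub L (S s i) r
    else if i \<in> Field \<alpha> then r = z else r = undefined)" for s i r
  have "\<exists>s. \<forall>i. P s i (s i)"
  proof (rule dependent_wf_choice)
    show "wf (\<alpha> - Id)" using \<alpha> by (simp add: well_order_on_def)
    show "P s i r = P t i r" if "\<And>j. (j, i) \<in> \<alpha> - Id \<Longrightarrow> s j = t j" for s t i r
    proof -
      have "S s i = S t i" unfolding S_def using that by (auto simp: underS_def)
      then show ?thesis unfolding P_def by simp
    qed
    show "\<exists>r. P s i r" for s i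
    proof (cases "i \<in> Field \<alpha>")
      case True
      have "S s i \<subseteq> Field L" using A(1) True unfolding S_def Field_lex_pow by auto
      with L(2) obtain r where "is_lub L (S s i) r" unfolding complete_order_def by blast
      then show ?thesis unfolding P_def by auto
    qed (simp add: P_def)
  qed
  then obtain s where s: "P s i (s i)" for i by blast
  have lub: "is_lub L (S s i) (s i)" if "i \<in> Field \<alpha>" "i \<in> D" for i
    using s[of i] that unfolding P_def by simp
  have out: "s i = z" if "i \<in> Field \<alpha> - D" for i
    using s[of i] that unfolding P_def by simp
  have sF: "s \<in> Field ?M"
    unfolding Field_lex_pow
  proof (rule PiE_I)
    show "s i \<in> Field L" if "i \<in> Field \<alpha>" for i
      using that lub[of i] out[of i] z unfolding is_lub_def by (cases "i \<in> D") auto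
    show "s i = undefined" if "i \<notin> Field \<alpha>" for i
      using s[of i] that unfolding P_def by simp
  qed
  have refl: "(s, s) \<in> ?M" using sF unfolding Field_lex_pow by (auto simp: lex_pow_def)
  show thesis
  proof (rule that[OF sF out])
    show "(a, s) \<in> ?M" if a: "a \<in> A" for a
    proof (cases "a = s")
      case False
      have aF: "a \<in> Field ?M" using A(1) a by blast
      obtain i where i: "i \<in> Field \<alpha>" "a i \<noteq> s i" "\<And>j. j \<in> underS \<alpha> i \<Longrightarrow> a j = s j"
        using lex_pow_first_difference[OF \<alpha> aF sF False] by blast
      \<comment> \<open>Off \<open>D\<close> both \<open>a\<close> and \<open>s\<close> take the
        value \<open>z\<close>, so the first difference lies in \<open>D\<close>, where
        \<open>s\<close> is a least upper bound.\<close>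
      then have "i \<in> D" using A(2)[OF a, of i] out[of i] by fastforce
      moreover have "a i \<in> S s i" unfolding S_def using a i(3) by blast
      ultimately have "(a i, s i) \<in> L" using lub[OF i(1)] unfolding is_lub_def by blast
      then show ?thesis using lex_powI[OF aF sF i(1) i(3)] i(2) by auto
    qed (use refl in simp)
    show "(s, t) \<in> ?M" if t: "t \<in> Field ?M" "\<And>i. i \<in> Field \<alpha> - D \<Longrightarrow> t i = z"
      and ub: "\<And>a. a \<in> A \<Longrightarrow> (a, t) \<in> ?M" for t
    proof (rule ccontr)
      assume "(s, t) \<notin> ?M"
      then have "strictly_below ?M t s"
        using Linear_order_not_le[OF Linear_order_lex_pow[OF L(1) \<alpha>] sF t(1)] by blast
      then obtain i where i: "i \<in> Field \<alpha>" "\<And>j. j \<in> underS \<alpha> i \<Longrightarrow> t j = s j"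
        "strictly_below L (t i) (s i)" by (rule lex_powE) blast
      have "i \<in> D" using i(1,3) out[of i] t(2)[of i] by auto
      \<comment> \<open>\<open>t i\<close> is too small to bound \<open>S s i\<close>, so some
        member of \<open>A\<close> that follows \<open>s\<close> up to \<open>i\<close> overtakes
        \<open>t\<close> there.\<close>
      then have "\<not> (\<forall>r\<in>S s i. (r, t i) \<in> L)"
        using lub[OF i(1)] strictly_below_Field[OF i(3)] strictly_below_not_le[OF L(1) i(3)]
        unfolding is_lub_def by blast
      then obtain a where a: "a \<in> A" "\<forall>j\<in>underS \<alpha> i. a j = s j" "(a i, t i) \<notin> L"
        unfolding S_def by blast
      have aF: "a \<in> Field ?M" using a A by blast
      have "strictly_below L (t i) (a i)"
        using Linear_order_not_le[OF L(1) _ _ a(3)] aF i(1) t(1) unfolding Field_lex_pow by auto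
      then have "strictly_below ?M t a"
        using lex_powI[OF t(1) aF i(1)] a(2) i(2) by auto
      then show False using ub[OF a(1)] lex_pow_irrefl[OF L(1) \<alpha>] by blast
    qed
  qed
qed

text \<open>With \<open>D = UNIV\<close> no coordinate is prescribed, and \<open>lex_pow_lub\<close>
  yields unrestricted least upper bounds.\<close>

lemma complete_order_lex_pow:
  assumes "Linear_order L" "complete_order L" "Well_order \<alpha>" "z \<in> Field L"
  shows "complete_order (lex_pow L \<alpha>)"
  unfolding complete_order_def
proof (intro allI impI)
  fix A assume "A \<subseteq> Field (lex_pow L \<alpha>)"
  then obtain s where "s \<in> Field (lex_pow L \<alpha>)" "\<And>a. a \<in> A \<Longrightarrow> (a, s) \<in> lex_pow L \<alpha>"
    "\<And>t. t \<in> Field (lex_pow L \<alpha>) \<Longrightarrow>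
       (\<And>a. a \<in> A \<Longrightarrow> (a, t) \<in> lex_pow L \<alpha>) \<Longrightarrow> (s, t) \<in> lex_pow L \<alpha>"
    using lex_pow_lub[OF assms, of A UNIV] by (metis DiffD2 UNIV_I)
  then show "\<exists>r. is_lub (lex_pow L \<alpha>) A r" unfolding is_lub_def by blast
qed

section \<open>The interval [-1,1]\<close>

lemma Field_I_order: "Field I_order = {-1..1}"
  unfolding Field_def I_order_def by auto

lemma strictly_below_I_order: "strictly_below I_order x y \<longleftrightarrow> x \<in> {-1..1} \<and> y \<in> {-1..1} \<and> x < y"
  unfolding I_order_def by auto

lemma Linear_order_I_order: "Linear_order I_order"
  unfolding order_on_defs Field_I_order
  by (auto simp: I_order_def refl_on_def trans_def antisym_def total_on_def)

lemma complete_order_I_order: "complete_order I_order"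
  unfolding complete_order_def
proof (intro allI impI)
  fix S assume "S \<subseteq> Field I_order"
  then have S: "S \<subseteq> {-1..1}" by (simp add: Field_I_order)
  show "\<exists>r. is_lub I_order S r"
  proof (cases "S = {}")
    \<comment> \<open>\<open>Sup {}\<close> carries no information for reals; the least upper bound
      of the empty set is the left endpoint.\<close>
    case True
    then have "is_lub I_order S (-1)" unfolding is_lub_def Field_I_order by (auto simp: I_order_def)
    then show ?thesis by blast
  next
    case False
    have bdd: "bdd_above S" using S by (meson bdd_above_Icc bdd_above_mono)
    have "Sup S \<le> 1" using False S by (intro cSup_least) auto
    moreover have "s \<le> Sup S" if "s \<in> S" for s using bdd that by (rule cSup_upper[rotated])
    moreover from this have "-1 \<le> Sup S" using False S
      by (metis all_not_in_conv atLeastAtMost_iff order.trans subset_iff)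
    ultimately have "is_lub I_order S (Sup S)"
      unfolding is_lub_def Field_I_order
      using False S by (auto simp: I_order_def intro: cSup_least)
    then show ?thesis by blast
  qed
qed

section \<open>Countable saturation\<close>

text \<open>Hausdorff's eta_1 property. Either set may be empty, so no countable set is cofinal or
  coinitial.\<close>

definition gaps_filled :: "'a rel \<Rightarrow> bool" where
  "gaps_filled L \<longleftrightarrow> (\<forall>A B. A \<subseteq> Field L \<and> B \<subseteq> Field L \<and> countable A \<and> countable B \<and>
     (\<forall>a\<in>A. \<forall>b\<in>B. strictly_below L a b) \<longrightarrow>
     (\<exists>x\<in>Field L. (\<forall>a\<in>A. strictly_below L a x) \<and> (\<forall>b\<in>B. strictly_below L x b)))"

section \<open>Countable subsets of omega1\<close>

lemma Card_order_omega1: "Card_order omega1"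
  unfolding omega1_def by (rule cardSuc_Card_order[OF natLeq_Card_order])

lemma Well_order_omega1: "Well_order omega1"
  using Card_order_omega1 by (simp add: card_order_on_def)

lemma Linear_order_omega1: "Linear_order omega1"
  by (rule Well_order_Linear[OF Well_order_omega1])

lemma countable_iff_less_omega1: "countable A \<longleftrightarrow> |A| <o omega1"
  unfolding omega1_def cardSuc_ordLeq_ordLess[OF natLeq_Card_order card_of_Card_order]
    countable_card_le_natLeq ..

lemma countable_underS_omega1: "i \<in> Field omega1 \<Longrightarrow> countable (underS omega1 i)"
  unfolding countable_iff_less_omega1 by (rule card_of_underS[OF Card_order_omega1])

lemma uncountable_omega1: "uncountable (Field omega1)"
  unfolding countable_iff_less_omega1
  using card_of_Field_ordIso[OF Card_order_omega1] not_ordLess_ordIso by blast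

text \<open>\<open>C\<close> together with the countably many countable segments below its members
  cannot exhaust an uncountable field; any point left over lies above all of
  \<open>C\<close>.\<close>

lemma omega1_bounded:
  assumes "countable C" "C \<subseteq> Field omega1"
  obtains \<delta> where "\<delta> \<in> Field omega1" "C \<subseteq> underS omega1 \<delta>"
proof -
  have "countable (C \<union> (\<Union>c\<in>C. underS omega1 c))"
    using assms countable_underS_omega1 by blast
  from countable_subset[OF _ this] uncountable_omega1
  obtain \<delta> where \<delta>: "\<delta> \<in> Field omega1" "\<delta> \<notin> C \<union> (\<Union>c\<in>C. underS omega1 c)"
    by (meson subsetI)
  then have "C \<subseteq> underS omega1 \<delta>"
    using assms(2) underS_cases[OF Linear_order_omega1 _ \<delta>(1)] by blast
  with \<delta>(1) show thesis by (rule that)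
qed

section \<open>Filling gaps between countable sets\<close>

text \<open>As \<open>x\<close> and \<open>y\<close> agree from \<open>\<delta>\<close> on, their
  first difference lies below \<open>\<delta>\<close> and survives any change at
  \<open>\<delta>\<close>.\<close>

lemma lex_pow_upd_above_difference:
  assumes "x \<in> Field (lex_pow L \<alpha>)" "y \<in> Field (lex_pow L \<alpha>)" "Linear_order \<alpha>"
    and "\<delta> \<in> Field \<alpha>" "c \<in> Field L" "strictly_below (lex_pow L \<alpha>) x y"
    and eq: "\<And>i. i \<in> Field \<alpha> - underS \<alpha> \<delta> \<Longrightarrow> x i = y i"
  shows "strictly_below (lex_pow L \<alpha>) (x(\<delta> := c)) y"
    and "strictly_below (lex_pow L \<alpha>) x (y(\<delta> := c))"
proof -
  obtain i where i: "i \<in> Field \<alpha>" "\<And>j. j \<in> underS \<alpha> i \<Longrightarrow> x j = y j" "strictly_below L (x i) (y i)"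
    using assms(6) by (rule lex_powE) blast
  have id: "i \<in> underS \<alpha> \<delta>" using i(1,3) eq[of i] by auto
  then have ne: "i \<noteq> \<delta>" by (auto simp: underS_def)
  have ne': "j \<noteq> \<delta>" if "j \<in> underS \<alpha> i" for j
    using underS_trans[OF assms(3) that id] by (auto simp: underS_def)
  show "strictly_below (lex_pow L \<alpha>) (x(\<delta> := c)) y"
    using i ne ne' by (intro lex_powI[OF Field_fun_upd[OF assms(1,4,5)] assms(2) i(1)]) auto
  show "strictly_below (lex_pow L \<alpha>) x (y(\<delta> := c))"
    using i ne ne' by (intro lex_powI[OF assms(1) Field_fun_upd[OF assms(2,4,5)] i(1)]) auto
qed

lemma gaps_filled_countable_support:
  assumes L: "Linear_order L" "complete_order L"
    and uv: "strictly_below L u z" "strictly_below L z v"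
  shows "gaps_filled (lex_pow_countable_support L z omega1)"
  unfolding gaps_filled_def
proof (intro allI impI, elim conjE)
  let ?S = "lex_pow_countable_support L z omega1" and ?M = "lex_pow L omega1"
  fix A B assume A: "A \<subseteq> Field ?S" "countable A" and B: "B \<subseteq> Field ?S" "countable B"
    and AB: "\<forall>a\<in>A. \<forall>b\<in>B. strictly_below ?S a b"
  note lin = Linear_order_countable_support[OF L(1) Well_order_omega1, of z]
  have z: "z \<in> Field L" and u: "u \<in> Field L" and v: "v \<in> Field L"
    using strictly_below_Field[OF uv(1)] strictly_below_Field[OF uv(2)] by auto
  \<comment> \<open>\<open>C\<close> collects all supports. A bound \<open>\<delta>\<close> for this
    countable set makes every member of \<open>A\<close> and \<open>B\<close> equal to
    \<open>z\<close> from \<open>\<delta>\<close> on.\<close>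
  define C where "C = (\<Union>x\<in>A \<union> B. {i \<in> Field omega1. x i \<noteq> z})"
  have "countable C"
    unfolding C_def using A B unfolding Field_lex_pow_countable_support by blast
  moreover have "C \<subseteq> Field omega1" unfolding C_def by blast
  ultimately obtain \<delta> where \<delta>: "\<delta> \<in> Field omega1" "C \<subseteq> underS omega1 \<delta>" by (rule omega1_bounded)
  have zero: "x i = z" if "x \<in> A \<union> B" "i \<in> Field omega1 - underS omega1 \<delta>" for x i
    using that \<delta>(2) unfolding C_def by blast
  have \<delta>z: "x \<delta> = z" if "x \<in> A \<union> B" for x
    using zero[OF that, of \<delta>] \<delta>(1) by (auto simp: underS_def)
  have SF: "x \<in> Field ?M" if "x \<in> Field ?S" for x
    using that unfolding Field_lex_pow_countable_support by simp
  have below: "strictly_below ?M a b" if "a \<in> A" "b \<in> B" for a b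
    by (rule strictly_below_lex_pow[OF bspec[OF bspec[OF AB that(1)] that(2)]])
  note S_iff = strictly_below_countable_support[where L = L and z = z and \<alpha> = omega1]
  \<comment> \<open>An empty \<open>A\<close> or \<open>B\<close> has no extreme element, so empty
    sets need no case of their own.\<close>
  consider (max) m where "m \<in> A" "\<And>a. a \<in> A \<Longrightarrow> (a, m) \<in> ?S"
    | (min) m where "m \<in> B" "\<And>b. b \<in> B \<Longrightarrow> (m, b) \<in> ?S"
    | (none) "\<And>m. m \<in> A \<Longrightarrow> \<exists>a\<in>A. (a, m) \<notin> ?S" "\<And>m. m \<in> B \<Longrightarrow> \<exists>b\<in>B. (m, b) \<notin> ?S"
    by blast
  then show "\<exists>x\<in>Field ?S. (\<forall>a\<in>A. strictly_below ?S a x) \<and> (\<forall>b\<in>B. strictly_below ?S x b)"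
  proof cases
    case max
    have mS: "m \<in> Field ?S" using max(1) A by blast
    \<comment> \<open>Raising the coordinate \<open>\<delta>\<close> from \<open>z\<close> to
      \<open>v\<close> moves past \<open>m\<close>, hence past \<open>A\<close>, but not past any
      \<open>b\<close>, which differs from \<open>m\<close> already below
      \<open>\<delta>\<close>.\<close>
    let ?x = "m(\<delta> := v)"
    have xS: "?x \<in> Field ?S" by (rule fun_upd_countable_support[OF mS \<delta>(1) v])
    have mx: "strictly_below ?S m ?x"
      unfolding S_iff[OF mS xS]
      by (rule strictly_below_fun_upd[OF SF[OF mS] \<delta>(1)]) (use \<delta>z[of m] max(1) uv in simp)
    have "strictly_below ?S a ?x" if "a \<in> A" for a
      by (rule le_strictly_below_trans[OF lin max(2)[OF that] mx])
    moreover have "strictly_below ?S ?x b" if b: "b \<in> B" for b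
    proof -
      have bS: "b \<in> Field ?S" using b B by blast
      show ?thesis
        unfolding S_iff[OF xS bS]
        by (rule lex_pow_upd_above_difference(1)[OF SF[OF mS] SF[OF bS] Linear_order_omega1 \<delta>(1) v
            below[OF max(1) b]]) (use zero[of m] zero[of b] max(1) b in auto)
    qed
    ultimately show ?thesis using xS by blast
  next
    case min
    have mS: "m \<in> Field ?S" using min(1) B by blast
    let ?x = "m(\<delta> := u)"
    have xS: "?x \<in> Field ?S" by (rule fun_upd_countable_support[OF mS \<delta>(1) u])
    have mx: "strictly_below ?S ?x m"
      unfolding S_iff[OF xS mS]
      by (rule fun_upd_strictly_below[OF SF[OF mS] \<delta>(1)]) (use \<delta>z[of m] min(1) uv in simp)
    have "strictly_below ?S ?x b" if "b \<in> B" for b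
      by (rule strictly_below_le_trans[OF lin mx min(2)[OF that]])
    moreover have "strictly_below ?S a ?x" if a: "a \<in> A" for a
    proof -
      have aS: "a \<in> Field ?S" using a A by blast
      show ?thesis
        unfolding S_iff[OF aS xS]
        by (rule lex_pow_upd_above_difference(2)[OF SF[OF aS] SF[OF mS] Linear_order_omega1 \<delta>(1) u
            below[OF a min(1)]]) (use zero[of m] zero[of a] min(1) a in auto)
    qed
    ultimately show ?thesis using xS by blast
  next
    case none
    have AM: "A \<subseteq> Field ?M" using A(1) SF by blast
    \<comment> \<open>Only sequences that are \<open>z\<close> from \<open>\<delta>\<close> on
      compete. This keeps the support of \<open>s\<close> countable, and the members of
      \<open>B\<close> are among the competing upper bounds.\<close>
    obtain s where s: "s \<in> Field ?M" "\<And>i. i \<in> Field omega1 - underS omega1 \<delta> \<Longrightarrow> s i = z"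
      "\<And>a. a \<in> A \<Longrightarrow> (a, s) \<in> ?M"
      "\<And>t. t \<in> Field ?M \<Longrightarrow> (\<And>i. i \<in> Field omega1 - underS omega1 \<delta> \<Longrightarrow> t i = z) \<Longrightarrow>
         (\<And>a. a \<in> A \<Longrightarrow> (a, t) \<in> ?M) \<Longrightarrow> (s, t) \<in> ?M"
      by (rule lex_pow_lub[OF L Well_order_omega1 z AM, of "underS omega1 \<delta>"]) (use zero in blast)+
    have "{i \<in> Field omega1. s i \<noteq> z} \<subseteq> underS omega1 \<delta>" using s(2) by blast
    then have "countable {i \<in> Field omega1. s i \<noteq> z}"
      by (rule countable_subset) (rule countable_underS_omega1[OF \<delta>(1)])
    then have sS: "s \<in> Field ?S" using s(1) unfolding Field_lex_pow_countable_support by simp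
    have "(a, s) \<in> ?S" if "a \<in> A" for a
      using s(3)[OF that] sS that A(1) unfolding Field_lex_pow_countable_support
      unfolding lex_pow_countable_support_def by blast
    \<comment> \<open>Belonging to \<open>A\<close> would make \<open>s\<close> its maximum;
      likewise for \<open>B\<close> and its minimum below. This is what makes the inequalities
      strict.\<close>
    moreover from this have "s \<notin> A" using none(1) by blast
    moreover have sB: "(s, b) \<in> ?S" if b: "b \<in> B" for b
    proof -
      have "(s, b) \<in> ?M"
        using b B(1) SF zero below by (intro s(4)) auto
      then show ?thesis using sS b B(1) unfolding Field_lex_pow_countable_support
        unfolding lex_pow_countable_support_def by blast
    qed
    moreover from this have "s \<notin> B" using none(2) by blast
    ultimately have "(\<forall>a\<in>A. strictly_below ?S a s) \<and> (\<forall>b\<in>B. strictly_below ?S s b)" by blast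
    with sS show ?thesis by blast
  qed
qed

section \<open>Extending increasing maps\<close>

lemma increasing_strictly_below_iff:
  assumes "Linear_order K" "Linear_order L" "increasing K L f" "x \<in> Field K" "y \<in> Field K"
  shows "strictly_below L (f x) (f y) \<longleftrightarrow> strictly_below K x y"
proof
  show "strictly_below K x y \<Longrightarrow> strictly_below L (f x) (f y)"
    using assms(3) unfolding increasing_def by blast
  assume fxy: "strictly_below L (f x) (f y)"
  have "\<not> strictly_below K y x"
    using assms(3) strictly_below_not_le[OF assms(2) fxy] unfolding increasing_def by blast
  then show "strictly_below K x y"
    using Linear_order_cases[OF assms(1,4,5)] fxy by blast
qed

lemma increasing_inj:
  assumes "Linear_order K" "increasing K L f" "x \<in> Field K" "y \<in> Field K" "f x = f y"
  shows "x = y"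
proof -
  have "f u \<noteq> f v" if "strictly_below K u v" for u v
    using assms(2) that unfolding increasing_def by blast
  then show ?thesis using assms(5) by (metis Linear_order_cases[OF assms(1,3,4)])
qed

text \<open>The forth half of a back-and-forth argument. The points of \<open>b\<close> are natural
  numbers and are treated in numerical order: a point \<open>i x\<close> receives
  \<open>f x\<close>, any other one receives a value in the gap left by \<open>f\<close> and the
  earlier choices.\<close>

lemma gaps_filled_countably_saturated:
  assumes L: "Linear_order L" "gaps_filled L"
  shows "countably_saturated L"
  unfolding countably_saturated_def
proof (intro allI impI, elim conjE)
  fix a b :: "nat rel" and i f
  assume a: "Linear_order a" and b: "Linear_order b"
    and i: "increasing a b i" and f: "increasing a L f"
  \<comment> \<open>Values of \<open>g\<close> are compared only with those at \<open>m < n\<close>,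
    so the recursion is along \<open><\<close> on the naturals. Comparison with \<open>f\<close>
    covers all of \<open>a\<close> at once, so later prescribed values are never blocked.\<close>
  define P where "P g n r \<longleftrightarrow> (n \<in> Field b \<longrightarrow> r \<in> Field L \<and>
      (\<forall>x\<in>Field a. (i x = n \<longrightarrow> r = f x) \<and> (strictly_below b (i x) n \<longrightarrow> strictly_below L (f x) r) \<and>
         (strictly_below b n (i x) \<longrightarrow> strictly_below L r (f x))) \<and>
      (\<forall>m\<in>Field b. m < n \<longrightarrow> (strictly_below b m n \<longrightarrow> strictly_below L (g m) r) \<and>
         (strictly_below b n m \<longrightarrow> strictly_below L r (g m))))"
    for g :: "nat \<Rightarrow> 'a" and n r
  have iF: "i x \<in> Field b" if "x \<in> Field a" for x using i that unfolding increasing_def by blast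
  have fF: "f x \<in> Field L" if "x \<in> Field a" for x using f that unfolding increasing_def by blast
  have fi: "strictly_below L (f x) (f y)"
    if "x \<in> Field a" "y \<in> Field a" "strictly_below b (i x) (i y)" for x y
    using increasing_strictly_below_iff[OF a b i that(1,2)] that(3) f unfolding increasing_def by blast
  have "\<exists>g. \<forall>n. P g n (g n)"
  proof (rule dependent_wf_choice)
    show "wf less_than" by (rule wf_less_than)
    show "P g n r = P h n r" if "\<And>m. (m, n) \<in> less_than \<Longrightarrow> g m = h m" for g h n r
      using that unfolding P_def by simp
    fix n g assume "\<And>m. (m, n) \<in> less_than \<Longrightarrow> P g m (g m)"
    then have g: "P g m (g m)" if "m < n" for m using that by simp
    show "\<exists>r. P g n r"
    proof (cases "n \<in> Field b")
      case n: True
      show ?thesis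
      proof (cases "\<exists>x\<in>Field a. i x = n")
        case True
        then obtain x where x: "x \<in> Field a" "i x = n" by blast
        have "f x = f y" if "y \<in> Field a" "i y = n" for y
          using increasing_inj[OF a i x(1) that(1)] x(2) that(2) by simp
        moreover have "strictly_below L (f y) (f x)" if "y \<in> Field a" "strictly_below b (i y) n" for y
          using fi[OF that(1) x(1)] that(2) x(2) by blast
        moreover have "strictly_below L (f x) (f y)" if "y \<in> Field a" "strictly_below b n (i y)" for y
          using fi[OF x(1) that(1)] that(2) x(2) by blast
        moreover have "strictly_below L (g m) (f x)"
          if "m \<in> Field b" "m < n" "strictly_below b m n" for m
          using g[OF that(2)] that x unfolding P_def by blast
        moreover have "strictly_below L (f x) (g m)"
          if "m \<in> Field b" "m < n" "strictly_below b n m" for m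
          using g[OF that(2)] that x unfolding P_def by blast
        ultimately have "P g n (f x)" using fF[OF x(1)] unfolding P_def by blast
        then show ?thesis by blast
      next
        case False
        \<comment> \<open>\<open>A\<close> and \<open>B\<close> consist of all values already fixed
          for points below and above \<open>n\<close>: those prescribed by \<open>f\<close> and the
          finitely many chosen so far.\<close>
        define A where "A = f ` {x \<in> Field a. strictly_below b (i x) n}
          \<union> g ` {m \<in> Field b. m < n \<and> strictly_below b m n}"
        define B where "B = f ` {x \<in> Field a. strictly_below b n (i x)}
          \<union> g ` {m \<in> Field b. m < n \<and> strictly_below b n m}"
        have gF: "g m \<in> Field L" if "m \<in> Field b" "m < n" for m
          using g[OF that(2)] that(1) unfolding P_def by blast
        have "strictly_below L (f x) (g m)"
          if "x \<in> Field a" "m \<in> Field b" "m < n" "strictly_below b (i x) m" for x m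
          using g[OF that(3)] that unfolding P_def by blast
        moreover have "strictly_below L (g m) (f x)"
          if "x \<in> Field a" "m \<in> Field b" "m < n" "strictly_below b m (i x)" for x m
          using g[OF that(3)] that unfolding P_def by blast
        moreover have "strictly_below L (g k) (g m)"
          if "k \<in> Field b" "m \<in> Field b" "k < n" "m < n" "strictly_below b k m" for k m
        proof -
          \<comment> \<open>Whichever of \<open>k\<close> and \<open>m\<close> is the larger number
            was chosen with regard to the other.\<close>
          have "k < m \<or> m < k" using that(5) by auto
          then show ?thesis using g[OF that(3)] g[OF that(4)] that unfolding P_def by blast
        qed
        ultimately have "\<forall>x\<in>A. \<forall>y\<in>B. strictly_below L x y"
          using fi strictly_below_trans[OF b, of _ n] unfolding A_def B_def by blast
        moreover have "A \<subseteq> Field L" "B \<subseteq> Field L" using fF gF unfolding A_def B_def by auto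
        moreover have "countable A" "countable B" unfolding A_def B_def by auto
        ultimately obtain r where "r \<in> Field L" "\<forall>x\<in>A. strictly_below L x r"
          "\<forall>y\<in>B. strictly_below L r y"
          using L(2) unfolding gaps_filled_def by metis
        then have "P g n r" using False unfolding P_def A_def B_def by blast
        then show ?thesis by blast
      qed
    qed (simp add: P_def)
  qed
  then obtain g where g: "P g n (g n)" for n by blast
  have "increasing b L g"
    unfolding increasing_def
  proof (intro conjI allI impI)
    show "g \<in> Field b \<rightarrow> Field L" using g unfolding P_def by blast
    fix m n assume mn: "strictly_below b m n"
    then have "m \<in> Field b" "n \<in> Field b" "m < n \<or> n < m" by (auto simp: Field_def)
    then have "strictly_below L (g m) (g n)" using g[of m] g[of n] mn unfolding P_def by blast
    then show "(g m, g n) \<in> L" "g m \<noteq> g n" by auto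
  qed
  moreover have "\<forall>x\<in>Field a. g (i x) = f x" using g iF unfolding P_def by blast
  ultimately show "\<exists>f'. increasing b L f' \<and> (\<forall>x\<in>Field a. f' (i x) = f x)" by blast
qed

section \<open>Cardinality and character\<close>

lemma card_I_order: "|Field I_order| =o continuum"
proof -
  have "|{-1..1::real}| =o |UNIV :: real set|"
    by (simp add: closed_interval_eqpoll_reals flip: eqpoll_iff_card_of_ordIso)
  also have "|UNIV :: real set| =o |UNIV :: nat set set|"
    using nat_sets_eqpoll_reals eqpoll_sym eqpoll_iff_card_of_ordIso by blast
  also have "|UNIV :: nat set set| =o continuum"
    using card_of_Pow_Func[of "UNIV :: nat set"]
    by (simp add: continuum_def cexp_def ctwo_def Field_card_of Field_natLeq)
  finally show ?thesis by (simp add: Field_I_order)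
qed

lemma card_Field_lex_pow: "|Field (lex_pow L \<alpha>)| = |Field L| ^c \<alpha>"
proof -
  have "Field \<alpha> \<rightarrow>\<^sub>E Field L = Func (Field \<alpha>) (Field L)" unfolding Func_def by auto
  then show ?thesis by (simp add: Field_lex_pow cexp_def Field_card_of)
qed

lemma Cinfinite_omega1: "Cinfinite omega1"
  using Card_order_omega1 uncountable_omega1 countable_finite unfolding cinfinite_def by blast

lemma Cnotzero_omega1: "Cnotzero omega1"
  by (rule Cinfinite_Cnotzero[OF Cinfinite_omega1])

section \<open>The order X and its zero sequence\<close>

lemma Linear_order_X: "Linear_order X_order"
  unfolding X_order_def by (rule Linear_order_lex_pow[OF Linear_order_I_order Well_order_omega1])

lemma complete_order_X: "complete_order X_order"
  unfolding X_order_def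
  by (rule complete_order_lex_pow[OF Linear_order_I_order complete_order_I_order Well_order_omega1])
    (auto simp: Field_I_order)

lemma X_zero_Field: "X_zero \<in> Field X_order"
  unfolding X_order_def X_zero_def by (rule lex_pow_const) (auto simp: Field_I_order)

text \<open>Moving one coordinate from 0 to -1 or 1 suffices. The arguments on countable supports
  need this room on both sides of the default value.\<close>

lemma X_zero_not_extreme:
  obtains u v where "strictly_below X_order u X_zero" "strictly_below X_order X_zero v"
proof -
  obtain i where i: "i \<in> Field omega1" using uncountable_omega1 by fastforce
  note zero = X_zero_Field[unfolded X_order_def]
  have "strictly_below X_order (X_zero(i := -1)) X_zero" unfolding X_order_def
    by (rule fun_upd_strictly_below[OF zero i])
      (simp add: I_order_def X_zero_def i)
  moreover have "strictly_below X_order X_zero (X_zero(i := 1))" unfolding X_order_def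
    by (rule strictly_below_fun_upd[OF zero i])
      (simp add: I_order_def X_zero_def i)
  ultimately show thesis by (rule that)
qed

lemma Linear_order_L_X: "Linear_order L_X"
  unfolding L_X_def by (rule Linear_order_countable_support[OF Linear_order_X Well_order_omega1])

lemma gaps_filled_L_X: "gaps_filled L_X"
proof -
  obtain u v where uv: "strictly_below X_order u X_zero" "strictly_below X_order X_zero v"
    by (rule X_zero_not_extreme)
  show ?thesis
    unfolding L_X_def by (rule gaps_filled_countable_support[OF Linear_order_X complete_order_X uv])
qed

lemma L_X_zero: "(\<lambda>\<alpha>\<in>Field omega1. X_zero) \<in> Field L_X"
  unfolding L_X_def Field_lex_pow_countable_support
  using lex_pow_const[OF X_zero_Field, of omega1] by simp

lemma card_L_X:
  assumes "continuum =o ctwo ^c omega1"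
  shows "|Field L_X| =o continuum"
proof -
  have "|Field L_X| \<le>o |Field (lex_pow X_order omega1)|"
    unfolding L_X_def Field_lex_pow_countable_support by (rule card_of_mono1) auto
  also have "|Field (lex_pow X_order omega1)| = ( |Field I_order| ^c omega1) ^c omega1"
    unfolding card_Field_lex_pow X_order_def ..
  \<comment> \<open>Exponents multiply, and \<open>omega1\<close> times itself has cardinality
    \<open>omega1\<close>, so the second power adds nothing.\<close>
  also have "( |Field I_order| ^c omega1) ^c omega1 =o |Field I_order| ^c omega1"
    by (rule cexp_cprod_ordLeq[OF card_of_Card_order Cinfinite_omega1 Cnotzero_omega1
          ordLeq_refl[OF Card_order_omega1]])
  also have "|Field I_order| ^c omega1 =o (ctwo ^c omega1) ^c omega1"
    by (rule cexp_cong1[OF ordIso_transitive[OF card_I_order assms] Card_order_omega1])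
  also have "(ctwo ^c omega1) ^c omega1 =o ctwo ^c omega1"
    by (rule cexp_cprod_ordLeq[OF Card_order_ctwo Cinfinite_omega1 Cnotzero_omega1
          ordLeq_refl[OF Card_order_omega1]])
  also have "ctwo ^c omega1 =o continuum" by (rule ordIso_symmetric[OF assms])
  finally have upper: "|Field L_X| \<le>o continuum" .
  obtain i where i: "i \<in> Field omega1" using uncountable_omega1 by fastforce
  \<comment> \<open>For the lower bound, a copy of the interval is placed in a single real
    coordinate, all other coordinates being zero.\<close>
  define e where "e r = (\<lambda>\<alpha>\<in>Field omega1. X_zero)(i := X_zero(i := r))" for r
  have "inj_on e (Field I_order)"
    unfolding e_def by (rule inj_onI) (metis fun_upd_same)
  moreover have "e ` Field I_order \<subseteq> Field L_X"
    unfolding e_def L_X_def X_order_def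
    by (auto intro!: fun_upd_countable_support Field_fun_upd i
        L_X_zero[unfolded L_X_def X_order_def] X_zero_Field[unfolded X_order_def])
  ultimately have "|Field I_order| \<le>o |Field L_X|" using card_of_ordLeq by blast
  then have "continuum \<le>o |Field L_X|"
    by (rule ordIso_ordLeq_trans[OF ordIso_symmetric[OF card_I_order]])
  with upper show ?thesis by (rule ordIso_iff_ordLeq[THEN iffD2, OF conjI])
qed

text \<open>A point is isolated by the two sequences obtained from it by changing one coordinate
  beyond its support, downwards or upwards.\<close>

lemma character_at_most_countable_support:
  assumes L: "Linear_order L" and uv: "strictly_below L u z" "strictly_below L z v"
  shows "character_at_most (lex_pow_countable_support L z omega1) omega1"
  unfolding character_at_most_def
proof
  let ?S = "lex_pow_countable_support L z omega1" and ?M = "lex_pow L omega1"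
  note lin = Linear_order_countable_support[OF L Well_order_omega1, of z]
  note S_iff = strictly_below_countable_support[where L = L and z = z and \<alpha> = omega1]
  have u: "u \<in> Field L" and v: "v \<in> Field L"
    using strictly_below_Field[OF uv(1)] strictly_below_Field[OF uv(2)] by auto
  fix l assume l: "l \<in> Field ?S"
  then have lM: "l \<in> Field ?M" and "countable {i \<in> Field omega1. l i \<noteq> z}"
    unfolding Field_lex_pow_countable_support by auto
  then obtain \<delta> where \<delta>: "\<delta> \<in> Field omega1" "{i \<in> Field omega1. l i \<noteq> z} \<subseteq> underS omega1 \<delta>"
    using omega1_bounded[of "{i \<in> Field omega1. l i \<noteq> z}"] by blast
  \<comment> \<open>All coordinates from \<open>\<delta>\<close> on, where \<open>l\<close> equals
    \<open>z\<close> and can be moved both ways. A single coordinate would not isolate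
    \<open>l\<close>; a cofinal set of them does.\<close>
  define D where "D = Field omega1 - underS omega1 \<delta>"
  have D: "i \<in> Field omega1" "l i = z" if "i \<in> D" for i using that \<delta>(2) unfolding D_def by auto
  define A where "A = (\<lambda>i. l(i := u)) ` D"
  define B where "B = (\<lambda>i. l(i := v)) ` D"
  have AS: "A \<subseteq> Field ?S" and BS: "B \<subseteq> Field ?S"
    unfolding A_def B_def using fun_upd_countable_support[OF l] u v D(1) by auto
  have Al: "strictly_below ?S a l" if a: "a \<in> A" for a
  proof -
    obtain i where i: "i \<in> D" "a = l(i := u)" using a unfolding A_def by blast
    have "strictly_below ?M a l"
      unfolding i(2) by (rule fun_upd_strictly_below[OF lM D(1)[OF i(1)]]) (simp add: D(2)[OF i(1)] uv)
    then show ?thesis using S_iff[OF subsetD[OF AS a] l] by blast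
  qed
  have lB: "strictly_below ?S l b" if b: "b \<in> B" for b
  proof -
    obtain i where i: "i \<in> D" "b = l(i := v)" using b unfolding B_def by blast
    have "strictly_below ?M l b"
      unfolding i(2) by (rule strictly_below_fun_upd[OF lM D(1)[OF i(1)]]) (simp add: D(2)[OF i(1)] uv)
    then show ?thesis using S_iff[OF l subsetD[OF BS b]] by blast
  qed
  have above: "\<exists>k\<in>D. i \<in> underS omega1 k" if i: "i \<in> Field omega1" for i
  proof -
    obtain k where k: "k \<in> Field omega1" "{i, \<delta>} \<subseteq> underS omega1 k"
      by (rule omega1_bounded[of "{i, \<delta>}"]) (use i \<delta>(1) in auto)
    have "k \<notin> underS omega1 \<delta>"
      using k(2) underS_trans[OF Linear_order_omega1, of \<delta> k \<delta>] by (auto simp: underS_def)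
    then show ?thesis using k unfolding D_def by blast
  qed
  have unique: "x = l" if x: "x \<in> Field ?S" "\<forall>a\<in>A. strictly_below ?S a x"
    "\<forall>b\<in>B. strictly_below ?S x b" for x
  proof (rule ccontr)
    assume ne: "x \<noteq> l"
    have xM: "x \<in> Field ?M" using x(1) unfolding Field_lex_pow_countable_support by simp
    obtain i where i: "i \<in> Field omega1" "x i \<noteq> l i" "\<And>j. j \<in> underS omega1 i \<Longrightarrow> x j = l j"
      using lex_pow_first_difference[OF Well_order_omega1 xM lM ne] by blast
    \<comment> \<open>A change of \<open>l\<close> at \<open>k\<close>, after the first difference
      from \<open>x\<close>, does not affect the comparison with \<open>x\<close>. So
      \<open>x\<close> lies outside the interval between \<open>l(k := u)\<close> and
      \<open>l(k := v)\<close>.\<close>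
    obtain k where k: "k \<in> D" "i \<in> underS omega1 k" using above[OF i(1)] by blast
    have kM: "l(k := c) \<in> Field ?M" if "c \<in> Field L" for c
      by (rule Field_fun_upd[OF lM D(1)[OF k(1)] that])
    have nk: "i \<noteq> k" using k(2) by (auto simp: underS_def)
    have nk': "j \<noteq> k" if "j \<in> underS omega1 i" for j
      using underS_trans[OF Linear_order_omega1 that k(2)] by (auto simp: underS_def)
    have "x i \<in> Field L" "l i \<in> Field L" using xM lM i(1) unfolding Field_lex_pow by auto
    then show False
    proof (rule Linear_order_cases[OF L])
      assume "strictly_below L (x i) (l i)"
      then have "strictly_below ?M x (l(k := u))"
        using i(3) nk nk' by (intro lex_powI[OF xM kM[OF u] i(1)]) auto
      moreover have aA: "l(k := u) \<in> A" using k(1) unfolding A_def by blast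
      ultimately have "strictly_below ?S x (l(k := u))"
        using S_iff[OF x(1) subsetD[OF AS aA]] by blast
      then show False using strictly_below_not_le[OF lin] bspec[OF x(2) aA] by blast
    next
      assume "strictly_below L (l i) (x i)"
      then have "strictly_below ?M (l(k := v)) x"
        using i(3) nk nk' by (intro lex_powI[OF kM[OF v] xM i(1)]) auto
      moreover have bB: "l(k := v) \<in> B" using k(1) unfolding B_def by blast
      ultimately have "strictly_below ?S (l(k := v)) x"
        using S_iff[OF subsetD[OF BS bB] x(1)] by blast
      then show False using strictly_below_not_le[OF lin] bspec[OF x(3) bB] by blast
    qed (use i(2) in simp)
  qed
  have card: "|h ` D| \<le>o omega1" for h :: "nat set \<Rightarrow> nat set \<Rightarrow> 'a"
  proof -
    have "|h ` D| \<le>o |Field omega1|"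
      using ordLeq_transitive[OF card_of_image card_of_mono1, of D "Field omega1" h] D(1) by blast
    then show ?thesis
      by (rule ordLeq_ordIso_trans) (rule card_of_Field_ordIso[OF Card_order_omega1])
  qed
  have AB: "strictly_below ?S a b" if "a \<in> A" "b \<in> B" for a b
    by (rule strictly_below_trans[OF lin Al[OF that(1)] lB[OF that(2)]])
  have only: "{x \<in> Field ?S. (\<forall>a\<in>A. strictly_below ?S a x) \<and> (\<forall>b\<in>B. strictly_below ?S x b)} = {l}"
  proof
    show "{x \<in> Field ?S. (\<forall>a\<in>A. strictly_below ?S a x) \<and> (\<forall>b\<in>B. strictly_below ?S x b)} \<subseteq> {l}"
      using unique by blast
    show "{l} \<subseteq> {x \<in> Field ?S. (\<forall>a\<in>A. strictly_below ?S a x) \<and> (\<forall>b\<in>B. strictly_below ?S x b)}"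
      using l Al lB by blast
  qed
  have cardAB: "|A| \<le>o omega1" "|B| \<le>o omega1" unfolding A_def B_def by (rule card)+
  have "\<forall>a\<in>A. \<forall>b\<in>B. strictly_below ?S a b" using AB by blast
  then show "\<exists>A B. A \<subseteq> Field ?S \<and> B \<subseteq> Field ?S \<and> |A| \<le>o omega1 \<and> |B| \<le>o omega1 \<and>
      (\<forall>a\<in>A. \<forall>b\<in>B. strictly_below ?S a b) \<and>
      {x \<in> Field ?S. (\<forall>a\<in>A. strictly_below ?S a x) \<and> (\<forall>b\<in>B. strictly_below ?S x b)} = {l}"
    by (intro exI[of _ A] exI[of _ B] conjI AS BS cardAB only)
qed

text \<open>If \<open>A < {l} < B\<close> with \<open>A\<close> countable, then some point lies between \<open>A\<close> and \<open>l\<close>, hence also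
  between \<open>A\<close> and \<open>B\<close>.\<close>

lemma gaps_filled_character:
  assumes L: "Linear_order L" "gaps_filled L" "l \<in> Field L"
    and \<mu>: "Card_order \<mu>" "character_at_most L \<mu>"
  shows "omega1 \<le>o \<mu>"
proof (rule ccontr)
  assume "\<not> omega1 \<le>o \<mu>"
  then have less: "\<mu> <o omega1"
    using not_ordLeq_iff_ordLess[OF _ Well_order_omega1] \<mu>(1) by (auto simp: card_order_on_def)
  obtain A B where A: "A \<subseteq> Field L" "|A| \<le>o \<mu>"
    and eq: "{x \<in> Field L. (\<forall>a\<in>A. strictly_below L a x) \<and> (\<forall>b\<in>B. strictly_below L x b)} = {l}"
    using \<mu>(2)[unfolded character_at_most_def, THEN bspec, OF L(3)]
    by (elim exE conjE) (rule that)
  have "l \<in> {x \<in> Field L. (\<forall>a\<in>A. strictly_below L a x) \<and> (\<forall>b\<in>B. strictly_below L x b)}"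
    unfolding eq by simp
  then have l: "\<And>a. a \<in> A \<Longrightarrow> strictly_below L a l" "\<And>b. b \<in> B \<Longrightarrow> strictly_below L l b" by auto
  have "countable A"
    unfolding countable_iff_less_omega1 by (rule ordLeq_ordLess_trans[OF A(2) less])
  then have "A \<subseteq> Field L \<and> {l} \<subseteq> Field L \<and> countable A \<and> countable {l} \<and>
     (\<forall>a\<in>A. \<forall>b\<in>{l}. strictly_below L a b)"
    using A(1) L(3) l(1) by blast
  then obtain x where x: "x \<in> Field L" "\<forall>a\<in>A. strictly_below L a x" "strictly_below L x l"
    using L(2)[unfolded gaps_filled_def, THEN spec[of _ A], THEN spec[of _ "{l}"], THEN mp] by blast
  have "strictly_below L x b" if "b \<in> B" for b
    by (rule strictly_below_trans[OF L(1) x(3) l(2)[OF that]])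
  then have "x \<in> {l}" unfolding eq[symmetric] using x(1,2) by blast
  then show False using x(3) by blast
qed

lemma has_character_L_X: "has_character L_X omega1"
proof -
  obtain u v where uv: "strictly_below X_order u X_zero" "strictly_below X_order X_zero v"
    by (rule X_zero_not_extreme)
  have "character_at_most L_X omega1"
    unfolding L_X_def by (rule character_at_most_countable_support[OF Linear_order_X uv])
  then show ?thesis
    unfolding has_character_def
    using Card_order_omega1 gaps_filled_character[OF Linear_order_L_X gaps_filled_L_X L_X_zero]
    by blast
qed

section \<open>The dimension\<close>

lemma Field_ord_prod:
  assumes "Linear_order \<alpha>" "Linear_order \<beta>"
  shows "Field (ord_prod \<alpha> \<beta>) = Field \<alpha> \<times> Field \<beta>"
proof
  show "Field (ord_prod \<alpha> \<beta>) \<subseteq> Field \<alpha> \<times> Field \<beta>" unfolding ord_prod_def Field_def by auto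
  have "(p, p) \<in> ord_prod \<alpha> \<beta>" if "p \<in> Field \<alpha> \<times> Field \<beta>" for p
    using that Linear_order_refl[OF assms(1)] unfolding ord_prod_def by auto
  then show "Field \<alpha> \<times> Field \<beta> \<subseteq> Field (ord_prod \<alpha> \<beta>)" by (blast intro: FieldI1)
qed

lemma underS_ord_prod:
  assumes "i \<in> Field \<alpha>" "j \<in> Field \<beta>"
  shows "(i', j') \<in> underS (ord_prod \<alpha> \<beta>) (i, j) \<longleftrightarrow>
    i' \<in> Field \<alpha> \<and> j' \<in> underS \<beta> j \<or> j' = j \<and> i' \<in> underS \<alpha> i"
  using assms unfolding underS_def ord_prod_def by (auto simp: Field_def)

lemma Well_order_ord_prod:
  assumes "Well_order \<alpha>" "Well_order \<beta>"
  shows "Well_order (ord_prod \<alpha> \<beta>)"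
proof -
  let ?P = "ord_prod \<alpha> \<beta>"
  note lin = Well_order_Linear[OF assms(1)] Well_order_Linear[OF assms(2)]
  have P: "((i, j), (i', j')) \<in> ?P \<longleftrightarrow> i \<in> Field \<alpha> \<and> i' \<in> Field \<alpha> \<and> j \<in> Field \<beta> \<and> j' \<in> Field \<beta> \<and>
      (strictly_below \<beta> j j' \<or> j = j' \<and> (i, i') \<in> \<alpha>)" for i j i' j'
    unfolding ord_prod_def by simp
  have "refl_on (Field ?P) ?P"
    unfolding Field_ord_prod[OF lin] using Linear_order_refl[OF lin(1)] by (auto simp: refl_on_def P)
  moreover have "trans ?P"
  proof (rule transI)
    fix p q r assume "(p, q) \<in> ?P" "(q, r) \<in> ?P"
    moreover obtain i j where "p = (i, j)" by (cases p)
    moreover obtain i' j' where "q = (i', j')" by (cases q)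
    moreover obtain i'' j'' where "r = (i'', j'')" by (cases r)
    moreover have "trans \<alpha>" using lin(1) by (auto simp: order_on_defs)
    ultimately show "(p, r) \<in> ?P"
      using strictly_below_trans[OF lin(2), of j j' j''] by (auto simp: P dest: transD)
  qed
  moreover have "antisym ?P"
  proof (rule antisymI)
    fix p q assume "(p, q) \<in> ?P" "(q, p) \<in> ?P"
    moreover obtain i j where "p = (i, j)" by (cases p)
    moreover obtain i' j' where "q = (i', j')" by (cases q)
    moreover have "antisym \<alpha>" using lin(1) by (auto simp: order_on_defs)
    ultimately show "p = q"
      using strictly_below_not_le[OF lin(2), of j j'] by (auto simp: P dest: antisymD)
  qed
  moreover have "total_on (Field ?P) ?P"
  proof (rule total_onI)
    fix p q assume "p \<in> Field ?P" "q \<in> Field ?P" "p \<noteq> q"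
    moreover obtain i j where "p = (i, j)" by (cases p)
    moreover obtain i' j' where "q = (i', j')" by (cases q)
    moreover have "total_on (Field \<alpha>) \<alpha>" "total_on (Field \<beta>) \<beta>"
      using lin by (auto simp: order_on_defs)
    ultimately show "(p, q) \<in> ?P \<or> (q, p) \<in> ?P"
      unfolding Field_ord_prod[OF lin] total_on_def by (auto simp: P)
  qed
  moreover have "wf (?P - Id)"
  \<comment> \<open>\<open><*lex*>\<close> compares first components first, whereas in
    \<open>ord_prod\<close> the second one is the most significant; hence the swap.\<close>
  proof (rule wf_subset)
    show "wf (inv_image ((\<beta> - Id) <*lex*> (\<alpha> - Id)) prod.swap)"
      using assms by (intro wf_inv_image wf_lex_prod) (auto simp: well_order_on_def)
    show "?P - Id \<subseteq> inv_image ((\<beta> - Id) <*lex*> (\<alpha> - Id)) prod.swap"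
      by (auto simp: P)
  qed
  ultimately show ?thesis
    by (auto simp: order_on_defs intro: FieldI1 FieldI2)
qed

text \<open>Flattening: the entries of the outer sequence become consecutive blocks. The first
  differing entry within the first differing block is the first difference of the flattened
  sequences.\<close>

lemma lex_pow_lex_pow_embeds:
  assumes "Linear_order \<alpha>" "Linear_order \<beta>"
  shows "increasing (lex_pow (lex_pow L \<alpha>) \<beta>) (lex_pow L (ord_prod \<alpha> \<beta>))
    (\<lambda>x. \<lambda>(i, j)\<in>Field (ord_prod \<alpha> \<beta>). x j i)" (is "increasing ?K ?M ?h")
proof -
  note F = Field_ord_prod[OF assms]
  have h: "?h x \<in> Field ?M" if "x \<in> Field ?K" for x
  proof -
    have "x j i \<in> Field L" if "i \<in> Field \<alpha>" "j \<in> Field \<beta>" for i j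
      using \<open>x \<in> Field ?K\<close> that unfolding Field_lex_pow by (blast dest: PiE_mem)
    then show ?thesis unfolding Field_lex_pow F by (auto intro!: restrict_PiE_iff[THEN iffD2])
  qed
  have "strictly_below ?M (?h x) (?h y)" if xy: "strictly_below ?K x y" for x y
  proof -
    obtain j where xyF: "x \<in> Field ?K" "y \<in> Field ?K" and j: "j \<in> Field \<beta>"
      "\<And>k. k \<in> underS \<beta> j \<Longrightarrow> x k = y k" "strictly_below (lex_pow L \<alpha>) (x j) (y j)"
      using lex_powE[OF xy] by metis
    obtain i where i: "i \<in> Field \<alpha>"
      "\<And>k. k \<in> underS \<alpha> i \<Longrightarrow> x j k = y j k" "strictly_below L (x j i) (y j i)"
      using lex_powE[OF j(3)] by metis
    have ij: "(i, j) \<in> Field (ord_prod \<alpha> \<beta>)" using i(1) j(1) by (simp add: F)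
    show ?thesis
    proof (rule lex_powI[OF h[OF xyF(1)] h[OF xyF(2)] ij])
      show "?h x q = ?h y q" if "q \<in> underS (ord_prod \<alpha> \<beta>) (i, j)" for q
        using that i(2) j(2) underS_ord_prod[OF i(1) j(1)] by (cases q) auto
      show "strictly_below L (?h x (i, j)) (?h y (i, j))" using i(3) ij by simp
    qed
  qed
  then show ?thesis using h unfolding increasing_def by blast
qed

text \<open>An increasing map \<open>f\<close> into the power over an initial segment is trapped: coordinate by
  coordinate we choose \<open>s\<close> such that all points whose code \<open>h x\<close> extends \<open>s\<close> have the same image so
  far. A suitable next value exists, since otherwise each of the uncountably many values \<open>r\<close> would
  give a nondegenerate interval of \<open>i\<close>-th coordinates of images, and these would be disjoint.\<close>

lemma not_embeds_initial_segment:
  assumes \<alpha>: "Well_order \<alpha>" and K: "Linear_order K"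
    and h: "increasing K (lex_pow I_order \<alpha>) h"
    and rich: "\<And>s. s \<in> underS \<alpha> p \<rightarrow> {-1..1} \<Longrightarrow> \<exists>x y. strictly_below K x y \<and>
      (\<forall>j\<in>underS \<alpha> p. h x j = s j \<and> h y j = s j)"
  shows "\<not> embeds K (lex_pow I_order (Restr \<alpha> (underS \<alpha> p)))"
proof
  let ?\<beta> = "Restr \<alpha> (underS \<alpha> p)"
  let ?M = "lex_pow I_order \<alpha>" and ?N = "lex_pow I_order ?\<beta>"
  note lin = Well_order_Linear[OF \<alpha>]
  note linM = Linear_order_lex_pow[OF Linear_order_I_order \<alpha>]
  assume "embeds K ?N"
  then obtain f where f: "increasing K ?N f" unfolding embeds_def by blast
  have fF: "f x \<in> Field ?N" if "x \<in> Field K" for x using f that unfolding increasing_def by blast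
  have hF: "h x \<in> Field ?M" if "x \<in> Field K" for x using h that unfolding increasing_def by blast
  define cone where "cone s i = {x \<in> Field K. \<forall>j\<in>underS \<alpha> i. h x j = s j}" for s :: "'a \<Rightarrow> real" and i
  \<comment> \<open>A value \<open>r\<close> is admissible at \<open>i\<close> if \<open>f\<close>
    has a constant \<open>i\<close>-th coordinate on all points continuing \<open>s\<close> by
    \<open>r\<close>. Outside the segment nothing is asked.\<close>
  define P where "P s i r \<longleftrightarrow> (i \<in> underS \<alpha> p \<longrightarrow> r \<in> {-1..1} \<and>
      (\<forall>x\<in>cone s i. \<forall>y\<in>cone s i. h x i = r \<and> h y i = r \<longrightarrow> f x i = f y i))" for s i r
  have "\<exists>s. \<forall>i. P s i (s i)"
  proof (rule dependent_wf_choice)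
    show "wf (\<alpha> - Id)" using \<alpha> by (simp add: well_order_on_def)
    show "P s i r = P t i r" if "\<And>j. (j, i) \<in> \<alpha> - Id \<Longrightarrow> s j = t j" for s t i r
    proof -
      have "cone s i = cone t i" unfolding cone_def using that by (auto simp: underS_def)
      then show ?thesis unfolding P_def by simp
    qed
    fix i s assume "\<And>j. (j, i) \<in> \<alpha> - Id \<Longrightarrow> P s j (s j)"
    then have IH: "P s j (s j)" if "j \<in> underS \<alpha> i" for j using that by (auto simp: underS_def)
    show "\<exists>r. P s i r"
    proof (rule ccontr)
      assume no: "\<nexists>r. P s i r"
      then have i: "i \<in> underS \<alpha> p" unfolding P_def by blast
      then have iF: "i \<in> Field \<alpha>" by (auto simp: underS_def Field_def)
      have agree: "f x j = f y j" if xy: "x \<in> cone s i" "y \<in> cone s i" and j: "j \<in> underS \<alpha> i" for x y j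
      proof -
        have "x \<in> cone s j" "y \<in> cone s j"
          using xy underS_trans[OF lin _ j] unfolding cone_def by auto
        moreover have "h x j = s j" "h y j = s j" using xy j unfolding cone_def by auto
        ultimately show ?thesis using IH[OF j] underS_trans[OF lin j i] unfolding P_def by blast
      qed
      \<comment> \<open>By \<open>agree\<close>, images of cone points coincide before
        \<open>i\<close>. Their order is therefore decided at \<open>i\<close> or later, which gives
        a weak inequality at \<open>i\<close>.\<close>
      have mono: "f x i \<le> f y i" if xy: "x \<in> cone s i" "y \<in> cone s i" "strictly_below K x y" for x y
      proof -
        have "strictly_below ?N (f x) (f y)" using f xy(3) unfolding increasing_def by blast
        then obtain k where k: "k \<in> Field ?\<beta>" "\<And>j. j \<in> underS ?\<beta> k \<Longrightarrow> f x j = f y j"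
          "strictly_below I_order (f x k) (f y k)" by (rule lex_powE) blast
        have kp: "k \<in> underS \<alpha> p" and kF: "k \<in> Field \<alpha>" using k(1) by (auto simp: Field_def)
        show ?thesis
        proof (rule underS_cases[OF lin kF iF])
          assume "k \<in> underS \<alpha> i"
          then show ?thesis using agree[OF xy(1,2)] k(3) by blast
        next
          assume "k = i"
          then show ?thesis using k(3) by (auto simp: strictly_below_I_order)
        next
          assume "i \<in> underS \<alpha> k"
          then have "i \<in> underS ?\<beta> k" using i kp by (auto simp: underS_def)
          then show ?thesis using k(2) by simp
        qed
      qed
      have "\<exists>x y. x \<in> cone s i \<and> y \<in> cone s i \<and> h x i = r \<and> h y i = r \<and> f x i < f y i"
        if r: "r \<in> {-1..1}" for r
      proof -
        obtain x y where "x \<in> cone s i" "y \<in> cone s i" "h x i = r" "h y i = r" "f x i \<noteq> f y i"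
          using no i r unfolding P_def by blast
        then show ?thesis by (cases "f x i < f y i") (fastforce, smt (verit))
      qed
      then obtain X Y where XY: "\<And>r. r \<in> {-1..1} \<Longrightarrow> X r \<in> cone s i \<and> Y r \<in> cone s i \<and>
          h (X r) i = r \<and> h (Y r) i = r \<and> f (X r) i < f (Y r) i" by metis
      \<comment> \<open>A rational inside each interval from \<open>f (X r) i\<close> to
        \<open>f (Y r) i\<close> will depend strictly monotonically on \<open>r\<close>, so
        \<open>[-1,1]\<close> would inject into the rationals.\<close>
      have "\<exists>q\<in>\<rat>. f (X r) i < q \<and> q < f (Y r) i" if "r \<in> {-1..1}" for r
        using XY[OF that] Rats_dense_in_real by blast
      then obtain q where q: "\<And>r. r \<in> {-1..1} \<Longrightarrow> q r \<in> \<rat> \<and> f (X r) i < q r \<and> q r < f (Y r) i"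
        by metis
      have less: "q r < q r'" if r: "r \<in> {-1..1}" "r' \<in> {-1..1}" "r < r'" for r r'
      proof -
        have KF: "Y r \<in> Field K" "X r' \<in> Field K"
          using XY[OF r(1)] XY[OF r(2)] unfolding cone_def by auto
        \<comment> \<open>Both codes follow \<open>s\<close> below \<open>i\<close> and then take
          the values \<open>r < r'\<close>; as \<open>h\<close> reflects the order, so are the
          points ordered in \<open>K\<close>.\<close>
        have "strictly_below ?M (h (Y r)) (h (X r'))"
          by (rule lex_powI[OF hF[OF KF(1)] hF[OF KF(2)] iF])
            (use XY[OF r(1)] XY[OF r(2)] r in \<open>auto simp: cone_def strictly_below_I_order I_order_def\<close>)
        then have "strictly_below K (Y r) (X r')"
          using increasing_strictly_below_iff[OF K linM h KF] by blast
        then have "f (Y r) i \<le> f (X r') i" using mono XY[OF r(1)] XY[OF r(2)] by blast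
        then show ?thesis using q[OF r(1)] q[OF r(2)] by linarith
      qed
      have "inj_on q {-1..1}"
        by (rule inj_onI) (metis less linorder_neqE less_irrefl)
      moreover have "countable (q ` {-1..1})"
        by (rule countable_subset[OF _ countable_rat]) (use q in auto)
      ultimately have "countable {-1..1::real}" by (rule countable_image_inj_on[rotated])
      then show False using uncountable_closed_interval[of "-1" 1] by simp
    qed
  qed
  then obtain s where s: "P s i (s i)" for i by blast
  have "s \<in> underS \<alpha> p \<rightarrow> {-1..1}" using s unfolding P_def by blast
  \<comment> \<open>Two distinct points follow \<open>s\<close> on the whole segment, yet
    admissibility at every coordinate forces their images to coincide.\<close>
  from rich[OF this] obtain x y where xy: "strictly_below K x y"
    and eq: "\<forall>j\<in>underS \<alpha> p. h x j = s j \<and> h y j = s j" by blast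
  have KF: "x \<in> Field K" "y \<in> Field K" using strictly_below_Field[OF xy] by auto
  have "strictly_below ?N (f x) (f y)" using f xy unfolding increasing_def by blast
  then obtain k where k: "k \<in> Field ?\<beta>" "strictly_below I_order (f x k) (f y k)"
    by (rule lex_powE) blast
  have kp: "k \<in> underS \<alpha> p" using k(1) by (auto simp: Field_def)
  have "x \<in> cone s k" "y \<in> cone s k"
    using KF eq underS_trans[OF lin _ kp] unfolding cone_def by auto
  then have "f x k = f y k" using s[of k] eq kp unfolding P_def by blast
  then show False using k(2) by simp
qed

section \<open>Both bounds for the dimension\<close>

lemma countable_support_embeds:
  "increasing (lex_pow_countable_support L z \<alpha>) (lex_pow L \<alpha>) (\<lambda>x. x)"
  unfolding increasing_def
  using strictly_below_lex_pow[where L = L and z = z and \<alpha> = \<alpha>]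
  by (auto simp: Field_lex_pow_countable_support)

lemma Well_order_omega1_squared: "Well_order (ord_prod omega1 omega1)"
  by (rule Well_order_ord_prod[OF Well_order_omega1 Well_order_omega1])

text \<open>Flattening gives one bound. For the other, a smaller ordinal is the segment below some
  \<open>p = (i, j)\<close>. It meets only the countably many blocks up to \<open>j\<close>, so
  every sequence on it extends to two points of countable support that first differ at
  \<open>p\<close>.\<close>

lemma is_I_dim_L_X: "is_I_dim L_X (ord_prod omega1 omega1)"
proof -
  let ?\<alpha> = "ord_prod omega1 omega1"
  note F = Field_ord_prod[OF Linear_order_omega1 Linear_order_omega1]
  define h :: "(nat set \<Rightarrow> nat set \<Rightarrow> real) \<Rightarrow> nat set \<times> nat set \<Rightarrow> real"
    where "h = (\<lambda>x. \<lambda>(i, j)\<in>Field ?\<alpha>. x j i)"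
  have h: "increasing L_X (lex_pow I_order ?\<alpha>) h"
    using increasing_comp[OF countable_support_embeds
        lex_pow_lex_pow_embeds[OF Linear_order_omega1 Linear_order_omega1]]
    unfolding L_X_def X_order_def h_def comp_def .
  have "?\<alpha> \<le>o \<beta>"
    if \<beta>: "Well_order \<beta>" "embeds L_X (lex_pow I_order \<beta>)" for \<beta> :: "(nat set \<times> nat set) rel"
  proof (rule ccontr)
    assume "\<not> ?\<alpha> \<le>o \<beta>"
    then have "\<beta> <o ?\<alpha>"
      using not_ordLeq_iff_ordLess[OF \<beta>(1) Well_order_omega1_squared] by simp
    then obtain p where p: "p \<in> Field ?\<alpha>" "\<beta> =o Restr ?\<alpha> (underS ?\<alpha> p)"
      using ordLess_iff_ordIso_Restr[OF Well_order_omega1_squared \<beta>(1)] by blast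
    have "embeds L_X (lex_pow I_order (Restr ?\<alpha> (underS ?\<alpha> p)))"
      by (rule embeds_lex_pow_ordIso[OF \<beta>(2) ordIso_symmetric[OF p(2)]])
    moreover have "\<not> embeds L_X (lex_pow I_order (Restr ?\<alpha> (underS ?\<alpha> p)))"
    proof (rule not_embeds_initial_segment[OF Well_order_omega1_squared Linear_order_L_X h])
      fix s :: "nat set \<times> nat set \<Rightarrow> real" assume s: "s \<in> underS ?\<alpha> p \<rightarrow> {-1..1}"
      obtain i j where ij: "p = (i, j)" "i \<in> Field omega1" "j \<in> Field omega1"
        using p(1) unfolding F by blast
      \<comment> \<open>The sequence \<open>s\<close> before \<open>p\<close>, the parameter
        \<open>c\<close> at \<open>p\<close>, zeros afterwards. The arguments are swapped because
        the block index is the outer one in \<open>L_X\<close> but the second one in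
        \<open>ord_prod\<close>.\<close>
      define x where "x c = (\<lambda>j'\<in>Field omega1. \<lambda>i'\<in>Field omega1.
        if (i', j') \<in> underS ?\<alpha> p then s (i', j') else if (i', j') = p then c else 0)" for c :: real
      have xX: "x c j' \<in> Field X_order" if "c \<in> {-1..1}" "j' \<in> Field omega1" for c j'
        using that s unfolding X_order_def Field_lex_pow Field_I_order x_def
        by (auto simp: PiE_iff Pi_iff)
      have xL: "x c \<in> Field L_X" if c: "c \<in> {-1..1}" for c
      proof -
        have "j' \<in> insert j (underS omega1 j)" if "j' \<in> Field omega1" "x c j' \<noteq> X_zero" for j'
        proof (rule ccontr)
          assume "j' \<notin> insert j (underS omega1 j)"
          then have "(i', j') \<notin> underS ?\<alpha> p \<and> (i', j') \<noteq> p" for i'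
            using underS_ord_prod[OF ij(2,3)] ij(1) by auto
          then have "x c j' = X_zero" using that(1) unfolding x_def X_zero_def by auto
          then show False using that(2) by simp
        qed
        then have "{j' \<in> Field omega1. x c j' \<noteq> X_zero} \<subseteq> insert j (underS omega1 j)" by blast
        moreover have "countable (insert j (underS omega1 j))"
          using countable_underS_omega1[OF ij(3)] by simp
        ultimately have "countable {j' \<in> Field omega1. x c j' \<noteq> X_zero}" by (rule countable_subset)
        moreover have "x c \<in> Field (lex_pow X_order omega1)"
          unfolding Field_lex_pow using xX[OF c] by (auto simp: x_def)
        ultimately show ?thesis unfolding L_X_def Field_lex_pow_countable_support by blast
      qed
      have hx: "h (x c) q = s q" if "q \<in> underS ?\<alpha> p" for c q
      proof -
        have "q \<in> Field ?\<alpha>" using that by (auto simp: underS_def Field_def)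
        then show ?thesis using that unfolding h_def x_def F by (auto split: prod.splits)
      qed
      have hp: "h (x c) p = c" for c
        using ij unfolding h_def x_def F by (simp add: underS_def)
      have I: "0 \<in> {-1..1::real}" "1 \<in> {-1..1::real}" by auto
      have hM: "h (x c) \<in> Field (lex_pow I_order ?\<alpha>)" if "c \<in> {-1..1}" for c
        using h xL[OF that] unfolding increasing_def by blast
      have "strictly_below (lex_pow I_order ?\<alpha>) (h (x 0)) (h (x 1))"
        by (rule lex_powI[OF hM[OF I(1)] hM[OF I(2)] p(1)]) (auto simp: hx hp I_order_def)
      then have "strictly_below L_X (x 0) (x 1)"
        using increasing_strictly_below_iff[OF Linear_order_L_X
            Linear_order_lex_pow[OF Linear_order_I_order Well_order_omega1_squared] h
            xL[OF I(1)] xL[OF I(2)]] by blast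
      then show "\<exists>x y. strictly_below L_X x y \<and> (\<forall>q\<in>underS ?\<alpha> p. h x q = s q \<and> h y q = s q)"
        using hx by blast
    qed
    ultimately show False by blast
  qed
  then show ?thesis
    unfolding is_I_dim_def embeds_def using Well_order_omega1_squared h by blast
qed

section \<open>Non-isomorphism\<close>

text \<open>Proper initial segments of \<open>omega1\<close> are countable, whereas below
  \<open>(i, j)\<close> with \<open>i\<close> before \<open>j\<close> lies the whole uncountable
  block \<open>i\<close>.\<close>

lemma omega1_squared_not_le_omega1: "\<not> ord_prod omega1 omega1 \<le>o omega1"
proof
  let ?\<alpha> = "ord_prod omega1 omega1"
  note F = Field_ord_prod[OF Linear_order_omega1 Linear_order_omega1]
  assume "?\<alpha> \<le>o omega1"
  then obtain g where g: "embed ?\<alpha> omega1 g" unfolding ordLeq_def by blast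
  obtain i where i: "i \<in> Field omega1" using uncountable_omega1 by fastforce
  obtain j where j: "j \<in> Field omega1" "{i} \<subseteq> underS omega1 j"
    by (rule omega1_bounded[of "{i}"]) (use i in auto)
  have ij: "(i, j) \<in> Field ?\<alpha>" using i j(1) by (simp add: F)
  have "bij_betw g (underS ?\<alpha> (i, j)) (underS omega1 (g (i, j)))"
    by (rule embed_underS[OF Well_order_omega1_squared g ij])
  moreover have "g (i, j) \<in> Field omega1"
    using embed_Field[OF g] ij by blast
  ultimately have "countable (underS ?\<alpha> (i, j))"
    using countable_underS_omega1 bij_betw_def countable_image_inj_on by metis
  moreover have "(\<lambda>k. (k, i)) ` Field omega1 \<subseteq> underS ?\<alpha> (i, j)"
    using underS_ord_prod[OF i j(1)] j(2) by auto
  ultimately have "countable ((\<lambda>k. (k, i)) ` Field omega1)" by (rule countable_subset[rotated])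
  then have "countable (Field omega1)" by (rule countable_image_inj_on) (simp add: inj_on_def)
  then show False using uncountable_omega1 by blast
qed

text \<open>\<open>iso\<close> is phrased through bijections between the sets \<open>under\<close>;
  monotonicity has to be read off from these.\<close>

lemma iso_increasing:
  assumes "Linear_order K" "iso K L f"
  shows "increasing K L f"
  unfolding increasing_def
proof (intro conjI allI impI)
  have bij: "bij_betw f (Field K) (Field L)" and em: "embed K L f" using assms(2) by (auto simp: iso_def)
  show "f \<in> Field K \<rightarrow> Field L" using bij by (auto simp: bij_betw_def)
  fix x y assume xy: "strictly_below K x y"
  then have F: "x \<in> Field K" "y \<in> Field K" using strictly_below_Field[OF xy] by auto
  show "f x \<noteq> f y" using bij xy F by (auto simp: bij_betw_def inj_on_def)
  have "f ` under K y = under L (f y)" using em F(2) by (auto simp: embed_def bij_betw_def)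
  then show "(f x, f y) \<in> L" using xy by (auto simp: under_def)
qed

text \<open>\<open>L_I\<close> lies inside the power of the interval over \<open>omega1\<close>, so
  an isomorphism would bring the dimension down to \<open>omega1\<close>.\<close>

lemma not_iso_L_X_L_I: "\<not> (\<exists>f. iso L_X L_I f)"
proof
  assume "\<exists>f. iso L_X L_I f"
  then obtain f where f: "increasing L_X L_I f" using iso_increasing[OF Linear_order_L_X] by blast
  have "increasing L_X (lex_pow I_order omega1) ((\<lambda>x. x) \<circ> f)"
    by (rule increasing_comp[OF f]) (unfold L_I_def, rule countable_support_embeds)
  then have "embeds L_X (lex_pow I_order omega1)" unfolding embeds_def by blast
  then have "ord_prod omega1 omega1 \<le>o omega1"
    by (rule is_I_dim_least[OF is_I_dim_L_X Well_order_omega1])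
  then show False using omega1_squared_not_le_omega1 by blast
qed

theorem theorem11:
  assumes "continuum =o ctwo ^c omega1"
  shows "Linear_order L_X \<and>
         countably_saturated L_X \<and>
         |Field L_X| =o continuum \<and>
         has_character L_X omega1 \<and>
         is_I_dim L_X (ord_prod omega1 omega1) \<and>
         \<not> (\<exists>f. iso L_X L_I f)"
  using Linear_order_L_X gaps_filled_countably_saturated[OF Linear_order_L_X gaps_filled_L_X]
    card_L_X[OF assms] has_character_L_X is_I_dim_L_X not_iso_L_X_L_I
  by blast

end
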